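(* Let $q,a,b\in\mathbb{R}$ be such that $|q|<1$, $0<b<1$, and $a^2(1-q)<4b$. Then the distribution of the Al-Salam--Chihara polynomials $\{p_n(x|q,a,b)\}_{n\ge0}$ (i.e. the probability measure on $\mathbb{R}$ with respect to which they are orthogonal) is absolutely continuous, with density on $x^2<4/(1-q)$ given by $$\frac{\sqrt{1-q}}{2\pi\sqrt{4-(1-q)x^2}}\prod_{k=0}^\infty\frac{(1-bq^k)\left(1-q^{k+1}\right)\left((1+q^k)^2-(1-q)x^2q^k\right)}{(1-bq^{2k})^2-(1-q)a\,q^k(1+bq^{2k})x+(1-q)(bx^2+a^2)q^{2k}}.$$
   Context: Notation: $[n]_q=1+q+\dots+q^{n-1}$, $[0]_q=0$. The convention $q^0=1$ is used also for $q=0$. The (renormalized) Al-Salam--Chihara polynomials $p_n(x)=p_n(x|q,a,b)$ are the monic polynomials defined by $p_{-1}(x)=0$, $p_0(x)=1$ and $$p_{n+1}(x)=(x-aq^n)p_n(x)-(1-bq^{n-1})[n]_q\,p_{n-1}(x)\quad(n\ge 0),$$ where the last term vanishes for $n=0$. *)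

theory Defs
  imports "HOL-Probability.Probability" "HOL-Computational_Algebra.Polynomial"
begin

definition q_bracket :: "real \<Rightarrow> nat \<Rightarrow> real" where
  "q_bracket q n = (\<Sum>i<n. q ^ i)"

text \<open>The recurrence \<open>p\<^sub>n\<^sub>+\<^sub>1 = (x - a q\<^sup>n) p\<^sub>n - (1 - b q\<^sup>n\<^sup>-\<^sup>1) [n]\<^sub>q p\<^sub>n\<^sub>-\<^sub>1\<close> is split at
  \<open>n = 0\<close>, where its last term vanishes, so that no negative index or exponent occurs; the
  last equation is the recurrence with \<open>n\<close> replaced by \<open>n + 1\<close>.\<close>

fun al_salam_chihara :: "real \<Rightarrow> real \<Rightarrow> real \<Rightarrow> nat \<Rightarrow> real poly" where
  "al_salam_chihara q a b 0 = 1"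
| "al_salam_chihara q a b (Suc 0) = [:- a, 1:]"
| "al_salam_chihara q a b (Suc (Suc n)) =
     [:- (a * q ^ Suc n), 1:] * al_salam_chihara q a b (Suc n)
     - smult ((1 - b * q ^ n) * q_bracket q (Suc n)) (al_salam_chihara q a b n)"

definition is_orthogonality_distribution :: "real measure \<Rightarrow> (nat \<Rightarrow> real poly) \<Rightarrow> bool" where
  "is_orthogonality_distribution M p \<longleftrightarrow>
     prob_space M \<and> sets M = sets borel \<and>
     (\<forall>m n. integrable M (\<lambda>x. poly (p m) x * poly (p n) x)) \<and>
     (\<forall>m n. m \<noteq> n \<longrightarrow> (\<integral>x. poly (p m) x * poly (p n) x \<partial>M) = 0)"

definition asc_denominator :: "real \<Rightarrow> real \<Rightarrow> real \<Rightarrow> real \<Rightarrow> nat \<Rightarrow> real" where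
  "asc_denominator q a b x k =
     (1 - b * q ^ (2 * k))\<^sup>2 - (1 - q) * a * q ^ k * (1 + b * q ^ (2 * k)) * x
     + (1 - q) * (b * x\<^sup>2 + a\<^sup>2) * q ^ (2 * k)"

definition asc_factor :: "real \<Rightarrow> real \<Rightarrow> real \<Rightarrow> real \<Rightarrow> nat \<Rightarrow> real" where
  "asc_factor q a b x k =
     (1 - b * q ^ k) * (1 - q ^ (k + 1)) * ((1 + q ^ k)\<^sup>2 - (1 - q) * x\<^sup>2 * q ^ k)
     / asc_denominator q a b x k"

definition asc_density :: "real \<Rightarrow> real \<Rightarrow> real \<Rightarrow> real \<Rightarrow> real" where
  "asc_density q a b x =
     (if x\<^sup>2 < 4 / (1 - q)
      then sqrt (1 - q) / (2 * pi * sqrt (4 - (1 - q) * x\<^sup>2)) * (\<Prod>k. asc_factor q a b x k)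
      else 0)"

end

theory Submission imports Defs "HOL-Complex_Analysis.Complex_Analysis" begin

text \<open>
  Put \<open>z = e\<^sup>i\<^sup>\<theta>\<close>, \<open>\<surd>(1 - q) x = z + 1/z\<close>, and let \<open>t, u\<close> be the conjugate numbers with
  \<open>t + u = \<surd>(1 - q) a\<close> and \<open>t u = b\<close>. Up to the constant \<open>(b, q; q)\<^sub>\<infinity>\<close>, the infinite product in the
  density is \<open>W = (z\<^sup>2, z\<^sup>-\<^sup>2; q)\<^sub>\<infinity> / (t z, t/z, u z, u/z; q)\<^sub>\<infinity>\<close>. Let \<open>J\<^sub>n(t, u)\<close> be the integral over
  the unit circle of \<open>W\<close> times the rescaled polynomial of degree \<open>n\<close>. Shifting the contour from
  \<open>z\<close> to \<open>q z\<close> gives \<open>J\<^sub>1 = 0\<close>. A contiguous relation for the polynomials yields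
  \<open>t J\<^sub>n\<^sub>+\<^sub>1(t, u) = (1 - t u q\<^sup>n) J\<^sub>n(t, u) - J\<^sub>n(q t, u)\<close>, so inductively \<open>J\<^sub>n = 0\<close> for \<open>n \<ge> 1\<close>,
  and for \<open>n = 0\<close> the relation iterates to \<open>(t u; q)\<^sub>\<infinity> J\<^sub>0(t, u) = J\<^sub>0(0, 0)\<close>.
  The remaining constant \<open>(q; q)\<^sub>\<infinity> J\<^sub>0(0, 0)\<close> is invariant under \<open>q \<mapsto> q\<^sup>2\<close> (take \<open>t = -u = \<surd>q\<close>),
  hence by continuity equal to its value \<open>4 \<pi>\<close> at \<open>q = 0\<close>.
  Uniqueness holds because orthogonality determines all moments and these grow at most
  geometrically, so that they determine the characteristic function.
\<close>

section \<open>Infinite $q$-shifted factorials\<close>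

definition qpoch :: "complex \<Rightarrow> complex \<Rightarrow> complex" where
  "qpoch q z = (\<Prod>k. 1 - z * q ^ k)"

lemma convergent_prod_qpoch:
  fixes q z :: complex
  assumes "norm q < 1"
  shows "convergent_prod (\<lambda>k. 1 - z * q ^ k)"
proof (rule abs_convergent_prod_imp_convergent_prod)
  have "summable (\<lambda>k. norm z * norm q ^ k)"
    using assms by (intro summable_mult summable_geometric) auto
  then have "summable (\<lambda>k. norm ((1 - z * q ^ k) - 1))"
    by (simp add: norm_mult norm_power)
  then show "abs_convergent_prod (\<lambda>k. 1 - z * q ^ k)"
    by (rule summable_imp_abs_convergent_prod)
qed

lemma has_prod_qpoch:
  assumes "norm q < 1"
  shows "(\<lambda>k. 1 - z * q ^ k) has_prod qpoch q z"
  unfolding qpoch_def using convergent_prod_qpoch[OF assms] by (rule convergent_prod_has_prod)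

lemma qpoch_LIMSEQ:
  assumes "norm q < 1"
  shows "(\<lambda>N. \<Prod>k<N. 1 - z * q ^ k) \<longlonglongrightarrow> qpoch q z"
  using convergent_prod_LIMSEQ[OF convergent_prod_qpoch[OF assms, of z]]
  by (simp add: qpoch_def LIMSEQ_lessThan_iff_atMost)

lemma qpoch_nonzero:
  assumes "norm q < 1" "norm z < 1"
  shows "qpoch q z \<noteq> 0"
  unfolding qpoch_def
proof (rule prodinf_nonzero)
  show "convergent_prod (\<lambda>k. 1 - z * q ^ k)" by (rule convergent_prod_qpoch) fact
  fix i
  have "norm (z * q ^ i) \<le> norm z * 1"
    unfolding norm_mult norm_power using assms by (intro mult_left_mono power_le_one) auto
  then have "norm (z * q ^ i) < 1" using assms by simp
  then show "1 - z * q ^ i \<noteq> 0" by auto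
qed

lemma qpoch_zero_right [simp]: "qpoch q 0 = 1"
  by (simp add: qpoch_def)

lemma qpoch_rec:
  assumes "norm q < 1"
  shows "qpoch q z = (1 - z) * qpoch q (q * z)"
proof -
  have 1: "(\<lambda>N. \<Prod>k<Suc N. 1 - z * q ^ k) \<longlonglongrightarrow> qpoch q z"
    using qpoch_LIMSEQ[OF assms, of z] by (rule LIMSEQ_Suc)
  have "(\<Prod>k<Suc N. 1 - z * q ^ k) = (1 - z) * (\<Prod>k<N. 1 - (q * z) * q ^ k)" for N
    unfolding prod.lessThan_Suc_shift by (simp add: algebra_simps)
  moreover have "(\<lambda>N. (1 - z) * (\<Prod>k<N. 1 - (q * z) * q ^ k)) \<longlonglongrightarrow> (1 - z) * qpoch q (q * z)"
    by (intro tendsto_mult tendsto_const qpoch_LIMSEQ assms)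
  ultimately show ?thesis using LIMSEQ_unique[OF 1] by simp
qed

lemma qpoch_zero_left [simp]: "qpoch 0 z = 1 - z"
  using qpoch_rec[of 0 z] by simp

text \<open>Group the factors of even and of odd index. Together with
  \<open>qpoch_mult_minus\<close> this relates the bases \<open>q\<close> and
  \<open>q\<^sup>2\<close> in \<open>hermite_mass_square\<close>.\<close>

lemma qpoch_even_odd:
  assumes "norm q < 1"
  shows "qpoch q z = qpoch (q\<^sup>2) z * qpoch (q\<^sup>2) (q * z)"
proof -
  have q2: "norm (q\<^sup>2) < 1"
    using assms by (simp add: norm_power power_less_one_iff)
  have 1: "(\<lambda>N. \<Prod>k<2*N. 1 - z * q ^ k) \<longlonglongrightarrow> qpoch q z"
    using LIMSEQ_subseq_LIMSEQ[OF qpoch_LIMSEQ[OF assms, of z], of "\<lambda>N. 2*N"]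
    by (simp add: strict_mono_def o_def)
  have "(\<Prod>k<2*N. 1 - z * q ^ k) =
      (\<Prod>k<N. 1 - z * (q\<^sup>2) ^ k) * (\<Prod>k<N. 1 - (q * z) * (q\<^sup>2) ^ k)" for N
  proof (induction N)
    case (Suc N)
    have e: "(q\<^sup>2) ^ N = q ^ (2 * N)" by (simp add: power_mult)
    have d: "2 * Suc N = Suc (Suc (2 * N))" by simp
    show ?case
      unfolding d prod.lessThan_Suc Suc.IH e power_Suc by (simp only: ac_simps)
  qed simp
  moreover have "(\<lambda>N. (\<Prod>k<N. 1 - z * (q\<^sup>2) ^ k) * (\<Prod>k<N. 1 - (q * z) * (q\<^sup>2) ^ k))
     \<longlonglongrightarrow> qpoch (q\<^sup>2) z * qpoch (q\<^sup>2) (q * z)"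
    by (intro tendsto_mult qpoch_LIMSEQ q2)
  ultimately show ?thesis using LIMSEQ_unique[OF 1] by simp
qed

lemma qpoch_mult_minus:
  assumes "norm q < 1"
  shows "qpoch q z * qpoch q (- z) = qpoch (q\<^sup>2) (z\<^sup>2)"
proof -
  have q2: "norm (q\<^sup>2) < 1"
    using assms by (simp add: norm_power power_less_one_iff)
  have "(\<lambda>N. (\<Prod>k<N. 1 - z * q ^ k) * (\<Prod>k<N. 1 - (- z) * q ^ k))
      \<longlonglongrightarrow> qpoch q z * qpoch q (- z)"
    by (intro tendsto_mult qpoch_LIMSEQ assms)
  moreover have "(1 - z * q ^ k) * (1 - (- z) * q ^ k) = 1 - z\<^sup>2 * (q\<^sup>2) ^ k" for k
    unfolding power_mult[symmetric] mult.commute[of 2 k]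
    unfolding power_mult power_mult_distrib[symmetric]
    by (simp add: algebra_simps power2_eq_square)
  then have "(\<Prod>k<N. 1 - z * q ^ k) * (\<Prod>k<N. 1 - (- z) * q ^ k) =
      (\<Prod>k<N. 1 - z\<^sup>2 * (q\<^sup>2) ^ k)" for N
    unfolding prod.distrib[symmetric] by (intro prod.cong refl)
  ultimately show ?thesis
    using LIMSEQ_unique[OF _ qpoch_LIMSEQ[OF q2, of "z\<^sup>2"]] by simp
qed

text \<open>The geometric majorant \<open>\<bar>R\<bar> * \<rho> ^ k\<close> serves all bases and
  arguments at once. Uniformity in the base matters because the total mass is later computed by
  letting the base tend to 0.\<close>

lemma uniform_limit_qpoch:
  assumes "0 \<le> \<rho>" "\<rho> < 1"
  shows "uniform_limit (cball 0 \<rho> \<times> cball 0 R) (\<lambda>N (q, z). \<Prod>k<N. 1 - z * q ^ k)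
    (\<lambda>(q, z). qpoch q z) sequentially"
proof -
  let ?A = "cball 0 \<rho> \<times> cball (0::complex) R :: (complex \<times> complex) set"
  have "uniformly_convergent_on ?A (\<lambda>N x. \<Prod>k<N. 1 + (- snd x * fst x ^ k))"
  proof (rule uniformly_convergent_on_prod)
    show "uniformly_convergent_on ?A (\<lambda>N x. \<Sum>k<N. norm (- snd x * fst x ^ k))"
    proof (rule Weierstrass_m_test'_ev)
      show "\<forall>\<^sub>F k in sequentially. \<forall>x\<in>?A. norm (norm (- snd x * fst x ^ k)) \<le> \<bar>R\<bar> * \<rho> ^ k"
        by (auto simp: norm_mult norm_power intro!: always_eventually mult_mono power_mono)
      show "summable (\<lambda>k. \<bar>R\<bar> * \<rho> ^ k)"
        using assms by (intro summable_mult summable_geometric) auto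
    qed
  qed (auto intro!: continuous_intros compact_Times)
  then obtain l where l: "uniform_limit ?A (\<lambda>N x. \<Prod>k<N. 1 + (- snd x * fst x ^ k)) l sequentially"
    unfolding uniformly_convergent_on_def by blast
  have "l x = qpoch (fst x) (snd x)" if x: "x \<in> ?A" for x
  proof -
    have "norm (fst x) < 1" using x assms(2) by auto
    from qpoch_LIMSEQ[OF this, of "snd x"] tendsto_uniform_limitI[OF l x]
    show ?thesis by (auto intro: LIMSEQ_unique)
  qed
  then show ?thesis
    using l uniform_limit_cong'[of ?A _ "\<lambda>N x. \<Prod>k<N. 1 - snd x * fst x ^ k" l
      "\<lambda>x. qpoch (fst x) (snd x)" sequentially]
    by (simp add: case_prod_unfold)
qed

text \<open>Continuity is local: a radius \<open>\<rho>\<close> strictly between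
  \<open>norm q\<close> and 1 makes the point interior to a product of discs on which the partial
  products converge uniformly.\<close>

lemma continuous_on_qpoch_joint: "continuous_on (ball 0 1 \<times> UNIV) (\<lambda>(q, z). qpoch q z)"
proof -
  have "isCont (\<lambda>(q, z). qpoch q z) (q, z)" if q: "norm q < 1" for q z
  proof -
    obtain \<rho> where \<rho>: "norm q < \<rho>" "\<rho> < 1" using dense[OF q] by blast
    have "0 \<le> \<rho>" using \<rho>(1) norm_ge_zero[of q] by linarith
    note ul = uniform_limit_qpoch[OF this \<rho>(2)]
    let ?A = "cball 0 \<rho> \<times> cball (0::complex) (norm z + 1) :: (complex \<times> complex) set"
    have "continuous_on ?A (\<lambda>(q, z). qpoch q z)"
      by (rule uniform_limit_theorem[OF _ ul])
         (auto simp: case_prod_unfold intro!: always_eventually continuous_intros)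
    moreover have "(q, z) \<in> interior ?A"
      using \<rho> by (simp add: interior_Times)
    ultimately show ?thesis by (rule continuous_on_interior)
  qed
  then show ?thesis
    by (auto intro!: continuous_at_imp_continuous_on)
qed

lemma continuous_on_qpoch [continuous_intros]:
  assumes "continuous_on A f" "continuous_on A g" "\<And>x. x \<in> A \<Longrightarrow> norm (f x) < 1"
  shows "continuous_on A (\<lambda>x. qpoch (f x) (g x))"
proof -
  have "continuous_on A (\<lambda>x. case (f x, g x) of (q, z) \<Rightarrow> qpoch q z)"
    by (rule continuous_on_compose2[OF continuous_on_qpoch_joint])
       (use assms in \<open>auto intro!: continuous_intros\<close>)
  then show ?thesis by simp
qed

lemma holomorphic_qpoch:
  assumes "norm q < 1"
  shows "qpoch q holomorphic_on UNIV"
proof (rule holomorphic_uniform_sequence)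
  show "(\<lambda>z. \<Prod>k<N. 1 - z * q ^ k) holomorphic_on UNIV" for N
    by (intro holomorphic_intros)
  fix z :: complex
  have "uniform_limit (cball 0 (norm z + 1)) (\<lambda>N z. \<Prod>k<N. 1 - z * q ^ k) (qpoch q) sequentially"
    using uniform_limit_qpoch[OF norm_ge_zero assms, of "norm z + 1"]
    by (auto simp: uniform_limit_iff elim!: eventually_mono)
  moreover have "cball z 1 \<subseteq> cball 0 (norm z + 1)"
    by (simp add: cball_subset_cball_iff dist_norm)
  ultimately show "\<exists>d>0. cball z d \<subseteq> UNIV \<and>
      uniform_limit (cball z d) (\<lambda>N z. \<Prod>k<N. 1 - z * q ^ k) (qpoch q) sequentially"
    by (intro exI[of _ 1]) (auto intro: uniform_limit_on_subset)
qed auto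

lemma holomorphic_on_qpoch [holomorphic_intros]:
  assumes "norm q < 1" "f holomorphic_on A"
  shows "(\<lambda>z. qpoch q (f z)) holomorphic_on A"
  using holomorphic_on_compose_gen[OF assms(2) holomorphic_qpoch[OF assms(1)]]
  by (simp add: o_def)

section \<open>Integrals over the unit circle\<close>

text \<open>The integral is taken with respect to the angle, that is to
  \<open>dz / (\<i> z)\<close>, without the factor \<open>1 / (2 * pi)\<close>.\<close>

definition circ_int :: "(complex \<Rightarrow> complex) \<Rightarrow> complex" where
  "circ_int F = integral {- pi..pi} (\<lambda>\<theta>. F (cis \<theta>))"

lemma circ_int_cong:
  assumes "\<And>z. norm z = 1 \<Longrightarrow> F z = G z"
  shows "circ_int F = circ_int G"
  unfolding circ_int_def by (rule integral_cong) (simp add: assms)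

lemma integrable_circ:
  fixes F :: "complex \<Rightarrow> complex"
  assumes "continuous_on (sphere 0 1) F"
  shows "(\<lambda>\<theta>. F (cis \<theta>)) integrable_on {a..b}"
proof (rule integrable_continuous_interval)
  show "continuous_on {a..b} (\<lambda>\<theta>. F (cis \<theta>))"
    by (rule continuous_on_compose2[OF assms]) (auto intro!: continuous_intros)
qed

lemma circ_int_add:
  assumes "continuous_on (sphere 0 1) F" "continuous_on (sphere 0 1) G"
  shows "circ_int (\<lambda>z. F z + G z) = circ_int F + circ_int G"
  unfolding circ_int_def by (intro Henstock_Kurzweil_Integration.integral_add integrable_circ assms)

lemma circ_int_diff:
  assumes "continuous_on (sphere 0 1) F" "continuous_on (sphere 0 1) G"
  shows "circ_int (\<lambda>z. F z - G z) = circ_int F - circ_int G"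
  unfolding circ_int_def by (intro Henstock_Kurzweil_Integration.integral_diff integrable_circ assms)

lemma circ_int_mult: "circ_int (\<lambda>z. c * F z) = c * circ_int F"
  unfolding circ_int_def by simp

lemma circ_int_minus: "circ_int (\<lambda>z. - F z) = - circ_int F"
  unfolding circ_int_def by simp

lemma circ_int_inverse: "circ_int (\<lambda>z. F (inverse z)) = circ_int F"
  using Henstock_Kurzweil_Integration.integral_reflect_real[of pi "- pi" "\<lambda>\<theta>. F (cis \<theta>)"]
  by (simp add: circ_int_def cis_inverse)

text \<open>Translation by \<open>pi\<close> swaps the two half circles. This is what admits
  negative \<open>q\<close> in \<open>circ_int_scale\<close>.\<close>

lemma circ_int_uminus:
  assumes "continuous_on (sphere 0 1) F"
  shows "circ_int (\<lambda>z. F (- z)) = circ_int F"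
proof -
  let ?f = "\<lambda>\<theta>. F (cis \<theta>)" and ?g = "\<lambda>\<theta>. F (- cis \<theta>)"
  have g: "?g integrable_on {- pi..pi}"
    by (rule integrable_circ, rule continuous_on_compose2[OF assms]) (auto intro!: continuous_intros)
  have "?g = ?f \<circ> (+) pi" by (simp add: fun_eq_iff cis_mult[symmetric])
  from integral_shift_Icc_real[of "- pi" 0 ?f pi, folded this]
  have 1: "integral {- pi..0} ?g = integral {0..pi} ?f" by simp
  have "?g = ?f \<circ> (+) (- pi)"
    by (simp add: fun_eq_iff cis_divide[symmetric])
  from integral_shift_Icc_real[of 0 pi ?f "- pi", folded this]
  have 2: "integral {0..pi} ?g = integral {- pi..0} ?f" by simp
  have "integral {- pi..0} ?g + integral {0..pi} ?g = integral {- pi..pi} ?g"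
    by (rule Henstock_Kurzweil_Integration.integral_combine) (use g in auto)
  moreover have "integral {- pi..0} ?f + integral {0..pi} ?f = integral {- pi..pi} ?f"
    by (rule Henstock_Kurzweil_Integration.integral_combine) (use integrable_circ[OF assms] in auto)
  ultimately show ?thesis using 1 2 by (simp add: circ_int_def add.commute)
qed

lemma contour_integral_circ_int:
  assumes "0 < r"
  shows "contour_integral (part_circlepath 0 r (- pi) pi) (\<lambda>z. k z / z) =
    \<i> * circ_int (\<lambda>z. k (of_real r * z))"
  using assms by (simp add: contour_integral_part_circlepath_eq circ_int_def mult.commute)

text \<open>The two circles are homotopic in \<open>A - {0}\<close>, where \<open>k z / z\<close> is
  holomorphic, so Cauchy's theorem equates the contour integrals.\<close>

lemma circ_int_annulus:
  assumes r: "0 < r" "r \<le> 1" and A: "open A" "k holomorphic_on A"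
    and sub: "\<And>z. r \<le> norm z \<Longrightarrow> norm z \<le> 1 \<Longrightarrow> z \<in> A"
  shows "circ_int (\<lambda>z. k (of_real r * z)) = circ_int k"
proof -
  have "contour_integral (part_circlepath 0 r (- pi) pi) (\<lambda>z. k z / z) =
      contour_integral (part_circlepath 0 1 (- pi) pi) (\<lambda>z. k z / z)"
  proof (rule Cauchy_theorem_homotopic_loops)
    show "homotopic_loops (A - {0}) (part_circlepath 0 r (- pi) pi) (part_circlepath 0 1 (- pi) pi)"
    proof (rule homotopic_loops_linear)
      fix s :: real
      define e where "e = exp (\<i> * complex_of_real (linepath (- pi) pi s))"
      have e: "norm e = 1" by (simp add: e_def linepath_def)
      show "closed_segment (part_circlepath 0 r (- pi) pi s) (part_circlepath 0 1 (- pi) pi s)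
          \<subseteq> A - {0}"
      proof
        fix w assume "w \<in> closed_segment (part_circlepath 0 r (- pi) pi s) (part_circlepath 0 1 (- pi) pi s)"
        then obtain x where x: "0 \<le> x" "x \<le> 1" "w = (1 - x) *\<^sub>R (of_real r * e) + x *\<^sub>R e"
          by (auto simp: closed_segment_def part_circlepath_def e_def)
        \<comment> \<open>The linear homotopy is radial: every modulus is a convex combination of
          \<open>r\<close> and 1 and stays in the annulus.\<close>
        have "w = of_real ((1 - x) * r + x) * e"
          using x(3) by (simp add: scaleR_conv_of_real algebra_simps)
        then have nw: "norm w = \<bar>(1 - x) * r + x\<bar>"
          using e by (simp add: norm_mult del: of_real_add of_real_mult)
        have "r * (1 - x) \<le> 1 * (1 - x)" "r * x \<le> 1 * x"
          using r x by (intro mult_right_mono; simp)+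
        then have "r \<le> (1 - x) * r + x" "(1 - x) * r + x \<le> 1"
          by (simp_all add: algebra_simps)
        with nw r have "r \<le> norm w" "norm w \<le> 1" by auto
        with sub r show "w \<in> A - {0}" by auto
      qed
    qed (auto simp: exp_eq_polar complex_eq_iff cis.code exp_Euler)
    show "(\<lambda>z. k z / z) holomorphic_on A - {0}"
      by (intro holomorphic_intros holomorphic_on_subset[OF A(2)]) auto
  qed (use A in auto)
  then show ?thesis
    using contour_integral_circ_int[OF r(1), of k] contour_integral_circ_int[of 1 k] by simp
qed

lemma circ_int_scale:
  fixes q :: real
  assumes q: "q \<noteq> 0" "\<bar>q\<bar> \<le> 1" and A: "open A" "k holomorphic_on A"
    and sub: "\<And>z. \<bar>q\<bar> \<le> norm z \<Longrightarrow> norm z \<le> 1 \<Longrightarrow> z \<in> A"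
  shows "circ_int (\<lambda>z. k (of_real q * z)) = circ_int k"
proof -
  have 1: "circ_int (\<lambda>z. k (of_real \<bar>q\<bar> * z)) = circ_int k"
    by (rule circ_int_annulus[of _ A]) (use assms in auto)
  have "continuous_on (sphere 0 1) (\<lambda>z. k (of_real q * z))"
    by (rule continuous_on_compose2[OF holomorphic_on_imp_continuous_on[OF A(2)]])
       (use q sub in \<open>auto intro!: continuous_intros simp: norm_mult\<close>)
  from circ_int_uminus[OF this]
  have "circ_int (\<lambda>z. k (of_real \<bar>q\<bar> * z)) = circ_int (\<lambda>z. k (of_real q * z))"
    by (cases "q \<ge> 0") auto
  with 1 show ?thesis by simp
qed

section \<open>Moments of the weight on the circle\<close>

text \<open>Here \<open>t\<close> and \<open>u\<close> are independent rather than conjugate: the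
  recursion below replaces \<open>t\<close> alone by \<open>q * t\<close>, and limits are taken at
  \<open>t = 0\<close>.\<close>

definition asc_weight :: "complex \<Rightarrow> complex \<Rightarrow> complex \<Rightarrow> complex \<Rightarrow> complex" where
  "asc_weight q t u z = qpoch q (z\<^sup>2) * qpoch q (inverse (z\<^sup>2)) /
     (qpoch q (t * z) * qpoch q (t / z) * qpoch q (u * z) * qpoch q (u / z))"

lemma asc_weight_commute: "asc_weight q t u z = asc_weight q u t z"
  by (simp add: asc_weight_def)

lemma continuous_on_asc_weight [continuous_intros]:
  assumes "continuous_on A q" "continuous_on A t" "continuous_on A u" "continuous_on A z"
    and "\<And>x. x \<in> A \<Longrightarrow> norm (q x) < 1" "\<And>x. x \<in> A \<Longrightarrow> norm (t x) < 1"
    "\<And>x. x \<in> A \<Longrightarrow> norm (u x) < 1" "\<And>x. x \<in> A \<Longrightarrow> norm (z x) = 1"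
  shows "continuous_on A (\<lambda>x. asc_weight (q x) (t x) (u x) (z x))"
  unfolding asc_weight_def
  using assms by (intro continuous_intros) (force simp: qpoch_nonzero norm_mult norm_divide)+

section \<open>Vanishing of the first moment by a contour shift\<close>

lemma kernel_identity:
  fixes z w t u :: complex
  assumes "z * w = 1"
  shows "(z + w - (t + u)) * ((1 - z\<^sup>2) * (1 - w\<^sup>2)) =
    z * (1 - z\<^sup>2) * ((1 - t * w) * (1 - u * w)) + w * (1 - w\<^sup>2) * ((1 - t * z) * (1 - u * z))"
  using assms by algebra

lemma one_minus_nonzero: "norm z < 1 \<Longrightarrow> 1 - z \<noteq> (0::complex)"
  by auto

text \<open>The integrand of \<open>J\<^sub>1\<close> is \<open>k(z) + k(1/z)\<close> for this function \<open>k\<close>. Since \<open>k(q z) = - k(1/z)\<close>, the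
  contour shift gives \<open>\<integral> k = - \<integral> k\<close>.\<close>

definition half_kernel :: "complex \<Rightarrow> complex \<Rightarrow> complex \<Rightarrow> complex \<Rightarrow> complex" where
  "half_kernel q t u z = z * qpoch q (z\<^sup>2) * qpoch q (q * inverse (z\<^sup>2)) /
     (qpoch q (t * z) * qpoch q (u * z) * qpoch q (q * (t * inverse z)) * qpoch q (q * (u * inverse z)))"

text \<open>Once the factor of index 0 is split off wherever it is present, all terms share the
  quotient \<open>P / D\<close>. What remains is a rational identity in \<open>z\<close> and
  \<open>w = 1/z\<close>, namely \<open>kernel_identity\<close> over the common denominator
  \<open>?E\<close>.\<close>

lemma asc_weight_half_kernel:
  assumes q: "norm q < 1" and t: "norm t < 1" and u: "norm u < 1" and z: "norm z = 1"
  shows "(z + inverse z - (t + u)) * asc_weight q t u z = half_kernel q t u z + half_kernel q t u (inverse z)"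
proof -
  define w where "w = inverse z"
  have "z \<noteq> 0" using z by auto
  have zw: "z * w = 1" and w: "norm w = 1" and iw: "inverse w = z"
    using z \<open>z \<noteq> 0\<close> by (auto simp: w_def norm_inverse)
  define P where "P = qpoch q (q * z\<^sup>2) * qpoch q (q * w\<^sup>2)"
  define D where "D = qpoch q (q * (t * z)) * qpoch q (q * (t * w)) * qpoch q (q * (u * z)) * qpoch q (q * (u * w))"
  have 1: "norm (t * z) < 1" "norm (t * w) < 1" "norm (u * z) < 1" "norm (u * w) < 1"
    using t u z w by (auto simp: norm_mult)
  then have nz: "1 - t * z \<noteq> 0" "1 - t * w \<noteq> 0" "1 - u * z \<noteq> 0" "1 - u * w \<noteq> 0"
    by (auto intro!: one_minus_nonzero)
  let ?E = "(1 - t * z) * (1 - t * w) * ((1 - u * z) * (1 - u * w))"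
  have r: "qpoch q (z\<^sup>2) = (1 - z\<^sup>2) * qpoch q (q * z\<^sup>2)"
    "qpoch q (w\<^sup>2) = (1 - w\<^sup>2) * qpoch q (q * w\<^sup>2)"
    "qpoch q (t * z) = (1 - t * z) * qpoch q (q * (t * z))"
    "qpoch q (t * w) = (1 - t * w) * qpoch q (q * (t * w))"
    "qpoch q (u * z) = (1 - u * z) * qpoch q (q * (u * z))"
    "qpoch q (u * w) = (1 - u * w) * qpoch q (q * (u * w))"
    by (rule qpoch_rec[OF q])+
  have d: "z / w = z * inverse w" "t / z = t * w" "u / z = u * w" "inverse (z\<^sup>2) = w\<^sup>2"
    "inverse (w\<^sup>2) = z\<^sup>2"
    using iw by (simp_all add: w_def divide_inverse power_inverse)
  have W: "asc_weight q t u z = ((1 - z\<^sup>2) * (1 - w\<^sup>2)) / ?E * (P / D)"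
    unfolding asc_weight_def d r P_def D_def times_divide_times_eq by (simp only: ac_simps)
  have cancel: "x / (b1 * b3 * y) = x * (b2 * b4) / (b1 * b2 * (b3 * b4) * y)"
    if "b2 \<noteq> 0" "b4 \<noteq> 0" for x b1 b2 b3 b4 y :: complex
    using that by simp
  have k1: "half_kernel q t u z = z * (1 - z\<^sup>2) * ((1 - t * w) * (1 - u * w)) / ?E * (P / D)"
  proof -
    have "half_kernel q t u z = (z * (1 - z\<^sup>2) * P) / ((1 - t * z) * (1 - u * z) * D)"
      unfolding half_kernel_def w_def[symmetric] d r P_def D_def by (simp only: ac_simps)
    moreover have "\<dots> = (z * (1 - z\<^sup>2) * P) * ((1 - t * w) * (1 - u * w)) / (?E * D)"
      by (rule cancel[OF nz(2,4)])
    ultimately show ?thesis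
      unfolding times_divide_times_eq by (simp only: ac_simps)
  qed
  have k2: "half_kernel q t u w = w * (1 - w\<^sup>2) * ((1 - t * z) * (1 - u * z)) / ?E * (P / D)"
  proof -
    have "half_kernel q t u w = (w * (1 - w\<^sup>2) * P) / ((1 - t * w) * (1 - u * w) * D)"
      unfolding half_kernel_def iw d r P_def D_def by (simp only: ac_simps)
    moreover have "\<dots> = (w * (1 - w\<^sup>2) * P) * ((1 - t * z) * (1 - u * z)) /
        ((1 - t * w) * (1 - t * z) * ((1 - u * w) * (1 - u * z)) * D)"
      by (rule cancel[OF nz(1,3)])
    ultimately show ?thesis
      unfolding times_divide_times_eq by (simp only: ac_simps)
  qed
  show ?thesis
    unfolding w_def[symmetric] W k1 k2
    unfolding distrib_right[symmetric] add_divide_distrib[symmetric] kernel_identity[OF zw, symmetric]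
    by simp
qed

text \<open>The denominators at \<open>q z\<close> and at \<open>1/z\<close> coincide. Each
  numerator contains one extra linear factor, and these match by
  \<open>q z (1 - w\<^sup>2 / q) = - w (1 - q z\<^sup>2)\<close>.\<close>

lemma half_kernel_scale:
  assumes q: "norm q < 1" "q \<noteq> 0" and z: "norm z = 1"
  shows "half_kernel q t u (q * z) = - half_kernel q t u (inverse z)"
proof -
  define w where "w = inverse z"
  have "z \<noteq> 0" using z by auto
  have zw: "z * w = 1" and w: "norm w = 1" and iw: "inverse w = z"
    using z \<open>z \<noteq> 0\<close> by (auto simp: w_def norm_inverse)
  have q1: "q * inverse ((q * z)\<^sup>2) = inverse q * w\<^sup>2"
    using q by (simp add: w_def power2_eq_square field_simps)
  have q2: "q * (c * inverse (q * z)) = c * w" for c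
    using q by (simp add: w_def field_simps)
  have q3: "q * (q * z\<^sup>2) = (q * z)\<^sup>2"
    by (simp add: power2_eq_square)
  have 1: "qpoch q (inverse q * w\<^sup>2) = (1 - inverse q * w\<^sup>2) * qpoch q (w\<^sup>2)"
    using qpoch_rec[OF q(1), of "inverse q * w\<^sup>2"] q by (simp add: mult.assoc[symmetric])
  have 2: "qpoch q (q * z\<^sup>2) = (1 - q * z\<^sup>2) * qpoch q ((q * z)\<^sup>2)"
    using qpoch_rec[OF q(1), of "q * z\<^sup>2"] by (simp add: q3)
  have 3: "q * z * (1 - inverse q * w\<^sup>2) = - (w * (1 - q * z\<^sup>2))"
    using right_inverse[OF q(2)] zw by algebra
  have w2: "inverse (w\<^sup>2) = z\<^sup>2"
    by (simp add: power_inverse[symmetric] iw)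
  let ?D = "qpoch q (t * w) * qpoch q (u * w) * qpoch q (q * (t * z)) * qpoch q (q * (u * z))"
  have "half_kernel q t u (q * z) =
      q * z * (1 - inverse q * w\<^sup>2) * (qpoch q ((q * z)\<^sup>2) * qpoch q (w\<^sup>2)) / ?D"
    unfolding half_kernel_def q1 q2 1 by (simp add: ac_simps)
  also have "\<dots> = - (w * (1 - q * z\<^sup>2) * (qpoch q ((q * z)\<^sup>2) * qpoch q (w\<^sup>2)) / ?D)"
    unfolding 3 by simp
  also have "w * (1 - q * z\<^sup>2) * (qpoch q ((q * z)\<^sup>2) * qpoch q (w\<^sup>2)) / ?D = half_kernel q t u w"
    unfolding half_kernel_def iw w2 2 by (simp only: ac_simps)
  finally show ?thesis by (simp add: w_def)
qed

text \<open>On this open set all factorials in the denominator of \<open>half_kernel\<close> have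
  arguments of modulus below 1, so there are no poles; it contains the closed annulus swept by the
  contour shift.\<close>

definition kernel_annulus :: "complex \<Rightarrow> complex \<Rightarrow> complex \<Rightarrow> complex set" where
  "kernel_annulus q t u = {z. z \<noteq> 0 \<and> norm (t * z) < 1 \<and> norm (u * z) < 1 \<and>
     norm (q * t) < norm z \<and> norm (q * u) < norm z}"

lemma open_kernel_annulus: "open (kernel_annulus q t u)"
  unfolding kernel_annulus_def
  by (intro open_Collect_conj open_Collect_neq open_Collect_less continuous_intros)

lemma mem_kernel_annulus:
  assumes t: "norm t < 1" and u: "norm u < 1" and z: "z \<noteq> 0" "norm q \<le> norm z" "norm z \<le> 1"
  shows "z \<in> kernel_annulus q t u"
proof -
  have "norm (c * z) < 1 \<and> norm (q * c) < norm z" if "norm c < 1" for c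
  proof
    show "norm (c * z) < 1"
      using that z mult_left_mono[of "norm z" 1 "norm c"] by (auto simp: norm_mult)
    have "norm q * norm c \<le> norm z * norm c" using z by (intro mult_right_mono) auto
    also have "\<dots> < norm z * 1" using z that by (intro mult_strict_left_mono) auto
    finally show "norm (q * c) < norm z" by (simp add: norm_mult)
  qed
  with t u z(1) show ?thesis by (simp add: kernel_annulus_def)
qed

lemma half_kernel_holomorphic:
  assumes "norm q < 1"
  shows "half_kernel q t u holomorphic_on kernel_annulus q t u"
proof -
  have "norm (q * (c * inverse z)) < 1" if "z \<noteq> 0" "norm (q * c) < norm z" for c z
    using that by (simp add: norm_mult norm_divide field_simps)
  then show ?thesis
    unfolding half_kernel_def [abs_def] kernel_annulus_def
    by (intro holomorphic_intros) (use assms in \<open>auto simp: qpoch_nonzero\<close>)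
qed

text \<open>For \<open>q = 0\<close> the shifted contour degenerates to a point, but \<open>k(z) / z\<close> is holomorphic at \<open>0\<close>.\<close>

lemma circ_int_half_kernel_0:
  assumes t: "norm t < 1" and u: "norm u < 1"
  shows "circ_int (half_kernel 0 t u) = 0"
proof -
  define g where "g = (\<lambda>z. (1 - z\<^sup>2) / ((1 - t * z) * (1 - u * z)))"
  define m where "m = max (norm t) (norm u)"
  \<comment> \<open>This radius satisfies \<open>1 < R\<close> and \<open>m * R < 1\<close>, also
    when \<open>m = 0\<close>, so \<open>g\<close> is holomorphic on a disc containing the closed
    unit disc.\<close>
  define R where "R = 2 / (1 + m)"
  have m: "0 \<le> m" "m < 1" "norm t \<le> m" "norm u \<le> m" using t u by (auto simp: m_def le_max_iff_disj)
  have R: "1 < R" "m * R < 1" using m by (auto simp: R_def field_simps)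
  have lt: "norm (c * z) < 1" if "norm z < R" "norm c \<le> m" for c z :: complex
  proof -
    have "norm c * norm z \<le> m * R" using that m by (intro mult_mono) auto
    then show ?thesis using R by (simp add: norm_mult)
  qed
  have "(g has_contour_integral 0) (part_circlepath 0 1 (- pi) pi)"
  proof (rule Cauchy_theorem_convex_simple)
    show "g holomorphic_on ball 0 R"
      unfolding g_def using one_minus_nonzero[OF lt[OF _ m(3)]] one_minus_nonzero[OF lt[OF _ m(4)]]
      by (intro holomorphic_intros) auto
    show "path_image (part_circlepath 0 1 (- pi) pi) \<subseteq> ball 0 R"
      using path_image_part_circlepath_subset'[of 1 0 "- pi" pi] R by (force simp: dist_norm)
  qed (auto simp: exp_eq_polar complex_eq_iff cis.code exp_Euler)
  then have "contour_integral (part_circlepath 0 1 (- pi) pi) g = 0"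
    by (rule contour_integral_unique)
  then have "integral {- pi..pi} (\<lambda>x. g (cis x) * \<i> * cis x) = 0"
    by (simp add: contour_integral_part_circlepath_eq)
  also have "(\<lambda>x. g (cis x) * \<i> * cis x) = (\<lambda>x. \<i> * half_kernel 0 t u (cis x))"
    by (simp add: g_def half_kernel_def fun_eq_iff divide_inverse ac_simps)
  finally show ?thesis by (simp add: circ_int_def)
qed

lemma circ_int_half_kernel:
  fixes q :: real and t u :: complex
  assumes q: "\<bar>q\<bar> < 1" and t: "norm t < 1" and u: "norm u < 1"
  shows "circ_int (half_kernel q t u) = 0"
proof (cases "q = 0")
  case True
  then show ?thesis using circ_int_half_kernel_0[OF t u] by simp
next
  case False
  let ?q = "complex_of_real q"
  have "circ_int (\<lambda>z. half_kernel q t u (?q * z)) = circ_int (half_kernel q t u)"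
    by (rule circ_int_scale[OF False _ open_kernel_annulus half_kernel_holomorphic])
       (use q t u False in \<open>auto intro!: mem_kernel_annulus\<close>)
  moreover have "circ_int (\<lambda>z. half_kernel q t u (?q * z)) = circ_int (\<lambda>z. - half_kernel q t u (inverse z))"
    by (rule circ_int_cong, rule half_kernel_scale) (use q False in auto)
  ultimately show ?thesis
    by (simp add: circ_int_minus circ_int_inverse)
qed

lemma continuous_on_half_kernel:
  assumes q: "norm q < 1" and t: "norm t < 1" and u: "norm u < 1"
  shows "continuous_on (sphere 0 1) (half_kernel q t u)"
proof (rule holomorphic_on_imp_continuous_on, rule holomorphic_on_subset[OF half_kernel_holomorphic[OF q]])
  show "sphere 0 1 \<subseteq> kernel_annulus q t u"
    using assms by (auto intro!: mem_kernel_annulus)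
qed

lemma circ_int_asc_weight_first:
  fixes q :: real and t u :: complex
  assumes q: "\<bar>q\<bar> < 1" and t: "norm t < 1" and u: "norm u < 1"
  shows "circ_int (\<lambda>z. (z + inverse z - (t + u)) * asc_weight q t u z) = 0"
proof -
  have q': "norm (complex_of_real q) < 1" using q by simp
  note cont = continuous_on_half_kernel[OF q' t u]
  have "circ_int (\<lambda>z. (z + inverse z - (t + u)) * asc_weight q t u z) =
      circ_int (\<lambda>z. half_kernel q t u z + half_kernel q t u (inverse z))"
    by (rule circ_int_cong, rule asc_weight_half_kernel) (use q' t u in auto)
  also have "\<dots> = circ_int (half_kernel q t u) + circ_int (\<lambda>z. half_kernel q t u (inverse z))"
    by (rule circ_int_add[OF cont], rule continuous_on_compose2[OF cont])
       (auto intro!: continuous_intros simp: norm_inverse)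
  also have "\<dots> = 0"
    unfolding circ_int_inverse circ_int_half_kernel[OF assms] by simp
  finally show ?thesis .
qed

text \<open>The polynomials in the variable \<open>y = \<surd>(1 - q) x\<close>, scaled by \<open>(1 - q)\<^bsup>n/2\<^esup>\<close> to stay monic.\<close>

fun asc_fun :: "complex \<Rightarrow> complex \<Rightarrow> complex \<Rightarrow> complex \<Rightarrow> nat \<Rightarrow> complex" where
  "asc_fun q t u y 0 = 1"
| "asc_fun q t u y (Suc 0) = y - (t + u)"
| "asc_fun q t u y (Suc (Suc n)) = (y - (t + u) * q ^ Suc n) * asc_fun q t u y (Suc n)
     - (1 - t * u * q ^ n) * (1 - q ^ Suc n) * asc_fun q t u y n"

lemma asc_fun_commute: "asc_fun q t u y n = asc_fun q u t y n"
  by (induction q t u y n rule: asc_fun.induct) (simp_all add: add.commute mult.commute)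

text \<open>With \<open>y = z + 1/z\<close> the factor on the left is
  \<open>(1 - t z) (1 - t/z)\<close>, exactly the ratio of the weights with parameters
  \<open>q t\<close> and \<open>t\<close>. The induction expands the left side by the recurrence for
  \<open>q t\<close> and inserts both hypotheses.\<close>

lemma asc_fun_contiguous:
  "(1 - y * t + t\<^sup>2) * asc_fun q (q * t) u y n =
     (1 - t * u * q ^ n) * asc_fun q t u y n - t * asc_fun q t u y (Suc n)"
proof (induction n rule: induct_nat_012)
  case 0
  then show ?case by (simp add: algebra_simps power2_eq_square)
next
  case 1
  then show ?case by (simp add: algebra_simps power2_eq_square)
next
  case (ge2 n)
  let ?D = "1 - y * t + t\<^sup>2" and ?Q = "asc_fun q t u y" and ?R = "asc_fun q (q * t) u y"
    and ?x = "q ^ n"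
  \<comment> \<open>The recurrence solved for its term of lowest degree, so that \<open>?Q n\<close>
    can be eliminated.\<close>
  have Z: "(1 - t * u * ?x) * (1 - q * ?x) * ?Q n = (y - (t + u) * (q * ?x)) * ?Q (Suc n) - ?Q (Suc (Suc n))"
    by (simp add: algebra_simps)
  have "?D * ?R (Suc (Suc n)) = (y - (q * t + u) * (q * ?x)) * (?D * ?R (Suc n))
     - (1 - q * t * u * ?x) * (1 - q * ?x) * (?D * ?R n)"
    by (simp add: algebra_simps)
  also have "\<dots> = (y - (q * t + u) * (q * ?x)) * ((1 - t * u * (q * ?x)) * ?Q (Suc n) - t * ?Q (Suc (Suc n)))
     - (1 - q * t * u * ?x) * ((1 - t * u * ?x) * (1 - q * ?x) * ?Q n)
     + (1 - q * t * u * ?x) * (1 - q * ?x) * t * ?Q (Suc n)"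
    unfolding ge2 power_Suc by (simp add: algebra_simps del: asc_fun.simps)
  also have "\<dots> = (1 - t * u * q ^ Suc (Suc n)) * ?Q (Suc (Suc n)) - t * ?Q (Suc (Suc (Suc n)))"
    unfolding Z asc_fun.simps(3)[of q t u y "Suc n"] power_Suc
    by (simp add: algebra_simps del: asc_fun.simps)
  finally show ?case .
qed

lemma continuous_on_asc_fun [continuous_intros]:
  assumes "continuous_on A q" "continuous_on A t" "continuous_on A u" "continuous_on A y"
  shows "continuous_on A (\<lambda>x. asc_fun (q x) (t x) (u x) (y x) n)"
proof (induction n rule: induct_nat_012)
  case (ge2 n)
  then show ?case using assms by (simp only: asc_fun.simps) (intro continuous_intros)
qed (use assms in \<open>auto intro!: continuous_intros\<close>)

text \<open>Replacing \<open>t\<close> by \<open>q * t\<close> deletes the first factor of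
  \<open>qpoch q (t * z)\<close> and of \<open>qpoch q (t / z)\<close>.\<close>

lemma asc_weight_shift:
  assumes q: "norm q < 1" and t: "norm t < 1" and u: "norm u < 1" and z: "norm z = 1"
  shows "asc_weight q (q * t) u z = (1 - (z + inverse z) * t + t\<^sup>2) * asc_weight q t u z"
proof -
  have "z \<noteq> 0" using z by auto
  have "norm (t * z) < 1" "norm (t / z) < 1"
    using t z by (simp_all add: norm_mult norm_divide)
  then have nz: "1 - t * z \<noteq> 0" "1 - t / z \<noteq> 0"
    by (simp_all only: one_minus_nonzero not_False_eq_True)
  have e: "1 - (z + inverse z) * t + t\<^sup>2 = (1 - t * z) * (1 - t / z)"
    using \<open>z \<noteq> 0\<close> by (simp add: field_simps power2_eq_square)
  have f: "qpoch q (t * z) = (1 - t * z) * qpoch q (q * t * z)"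
    "qpoch q (t / z) = (1 - t / z) * qpoch q (q * t / z)"
    using qpoch_rec[OF q, of "t * z"] qpoch_rec[OF q, of "t / z"] by (simp_all add: mult.assoc)
  have cancel: "x / (a * a' * b * b') = c * d * (x / (c * a * (d * a') * b * b'))"
    if "c \<noteq> 0" "d \<noteq> 0" for x a a' b b' c d :: complex
    using that by simp
  show ?thesis
    unfolding e asc_weight_def f by (rule cancel[OF nz])
qed

section \<open>The moments \<open>J_n(t, u)\<close> and their recursion\<close>

definition asc_moment :: "complex \<Rightarrow> complex \<Rightarrow> complex \<Rightarrow> nat \<Rightarrow> complex" where
  "asc_moment q t u n = circ_int (\<lambda>z. asc_fun q t u (z + inverse z) n * asc_weight q t u z)"

lemma asc_moment_commute: "asc_moment q t u n = asc_moment q u t n"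
  unfolding asc_moment_def by (simp add: asc_fun_commute[of q t] asc_weight_commute[of q t])

text \<open>The base is allowed to vary along with \<open>t\<close> and \<open>u\<close>, since it
  tends to 0 in \<open>hermite_mass_eq\<close>.\<close>

lemma continuous_on_asc_moment:
  assumes "continuous_on A q" "continuous_on A t" "continuous_on A u"
    and "\<And>x. x \<in> A \<Longrightarrow> norm (q x) < 1" "\<And>x. x \<in> A \<Longrightarrow> norm (t x) < 1"
    "\<And>x. x \<in> A \<Longrightarrow> norm (u x) < 1"
  shows "continuous_on A (\<lambda>x. asc_moment (q x) (t x) (u x) n)"
proof -
  have f: "continuous_on (A \<times> cbox (- pi) pi) (\<lambda>x. f (fst x))" if "continuous_on A f" for f :: "'a \<Rightarrow> complex"
    by (rule continuous_on_compose2[OF that]) (auto intro!: continuous_intros)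
  have "continuous_on A (\<lambda>x. integral (cbox (- pi) pi)
      (\<lambda>\<theta>. asc_fun (q x) (t x) (u x) (cis \<theta> + inverse (cis \<theta>)) n * asc_weight (q x) (t x) (u x) (cis \<theta>)))"
    by (rule integral_continuous_on_param, unfold case_prod_unfold)
       (intro continuous_intros f; use assms in auto)
  then show ?thesis by (simp add: asc_moment_def circ_int_def)
qed

text \<open>The quadratic factor of \<open>asc_weight_shift\<close> is the one on the left of
  \<open>asc_fun_contiguous\<close>, so weight and polynomial shift together under the
  integral.\<close>

lemma asc_moment_shift:
  fixes q :: real and t u :: complex
  assumes q: "\<bar>q\<bar> < 1" and t: "norm t < 1" and u: "norm u < 1"
  shows "asc_moment q (q * t) u n = (1 - t * u * of_real q ^ n) * asc_moment q t u n - t * asc_moment q t u (Suc n)"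
proof -
  let ?q = "complex_of_real q"
  let ?g = "\<lambda>n z. asc_fun ?q t u (z + inverse z) n * asc_weight ?q t u z"
  have cont: "continuous_on (sphere 0 1) (?g n)" for n
    by (intro continuous_intros) (use q t u in auto)
  have "asc_moment q (q * t) u n = circ_int (\<lambda>z. (1 - t * u * ?q ^ n) * ?g n z - t * ?g (Suc n) z)"
    unfolding asc_moment_def
  proof (rule circ_int_cong)
    fix z :: complex assume z: "norm z = 1"
    have "asc_fun ?q (?q * t) u (z + inverse z) n * asc_weight ?q (?q * t) u z =
       ((1 - (z + inverse z) * t + t\<^sup>2) * asc_fun ?q (?q * t) u (z + inverse z) n) * asc_weight ?q t u z"
      using asc_weight_shift[of ?q t u z] q t u z by simp
    also have "\<dots> = (1 - t * u * ?q ^ n) * ?g n z - t * ?g (Suc n) z"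
      unfolding asc_fun_contiguous by (simp only: left_diff_distrib mult.assoc)
    finally show "asc_fun ?q (?q * t) u (z + inverse z) n * asc_weight ?q (?q * t) u z =
      (1 - t * u * ?q ^ n) * ?g n z - t * ?g (Suc n) z" .
  qed
  also have "\<dots> = (1 - t * u * ?q ^ n) * circ_int (?g n) - t * circ_int (?g (Suc n))"
    by (subst circ_int_diff) (auto intro!: continuous_on_mult_left cont simp del: asc_fun.simps simp: circ_int_mult)
  finally show ?thesis unfolding asc_moment_def .
qed

lemma asc_moment_Suc_0:
  fixes q :: real and t u :: complex
  assumes "\<bar>q\<bar> < 1" "norm t < 1" "norm u < 1"
  shows "asc_moment q t u (Suc 0) = 0"
  using circ_int_asc_weight_first[OF assms] by (simp add: asc_moment_def)

text \<open>By the shift relation, \<open>t\<close> times the next moment is a combination of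
  vanishing ones, which settles \<open>t \<noteq> 0\<close>. Symmetry settles
  \<open>u \<noteq> 0\<close>, and a limit settles \<open>t = u = 0\<close>.\<close>

lemma asc_moment_Suc:
  fixes q :: real and t u :: complex
  assumes q: "\<bar>q\<bar> < 1" and "norm t < 1" "norm u < 1"
  shows "asc_moment q t u (Suc n) = 0"
  using assms(2,3)
proof (induction n arbitrary: t u)
  case 0
  then show ?case using asc_moment_Suc_0[OF q] by simp
next
  case (Suc n)
  let ?f = "\<lambda>t u. asc_moment q t u (Suc (Suc n))"
  have 1: "?f t u = 0" if t: "norm t < 1" "t \<noteq> 0" and u: "norm u < 1" for t u
  proof -
    have "norm (of_real q * t) \<le> 1 * norm t"
      unfolding norm_mult using q by (intro mult_right_mono) auto
    then have "norm (of_real q * t) < 1" using t by simp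
    then have "t * ?f t u = 0"
      using asc_moment_shift[OF q t(1) u, of "Suc n"] Suc.IH t u by simp
    with t show ?thesis by simp
  qed
  \<comment> \<open>Even for \<open>t, u \<noteq> 0\<close> this case is reached through \<open>q t\<close> and \<open>q u\<close> when \<open>q = 0\<close>.\<close>
  have 2: "?f 0 0 = 0"
  proof -
    \<comment> \<open>The values \<open>1 / (k + 2)\<close> are nonzero and, unlike
      \<open>1 / (k + 1)\<close> at \<open>k = 0\<close>, strictly below 1.\<close>
    let ?x = "\<lambda>k. complex_of_real (inverse (real (Suc (Suc k))))"
    have lim: "?x \<longlonglongrightarrow> 0"
      using tendsto_of_real[OF LIMSEQ_Suc[OF LIMSEQ_inverse_real_of_nat], where 'a = complex]
      by (simp only: of_real_0)
    have lt: "norm (?x k) < 1" for k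
      unfolding norm_of_real by (simp add: inverse_less_1_iff)
    have "continuous_on (ball 0 1) (\<lambda>t. ?f t 0)"
      by (rule continuous_on_asc_moment) (use q in \<open>auto intro!: continuous_intros\<close>)
    from continuous_on_tendsto_compose[OF this lim]
    have "(\<lambda>k. ?f (?x k) 0) \<longlonglongrightarrow> ?f 0 0" using lt by simp
    moreover have "?f (?x k) 0 = 0" for k
    proof (rule 1[OF lt])
      show "?x k \<noteq> 0" unfolding of_real_eq_0_iff by simp
    qed simp
    ultimately show ?thesis by (simp add: LIMSEQ_const_iff)
  qed
  show ?case
  proof (cases "t = 0")
    case False
    with Suc.prems 1 show ?thesis by blast
  next
    case True
    show ?thesis
    proof (cases "u = 0")
      case False
      have "?f t u = ?f u t" by (rule asc_moment_commute)
      with False Suc.prems 1 show ?thesis by simp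
    qed (use True 2 in simp)
  qed
qed

text \<open>As the first moment vanishes, each replacement of \<open>t\<close> by
  \<open>q * t\<close> multiplies the zeroth moment by one factor of \<open>qpoch q (t * u)\<close>,
  while the parameter tends to 0.\<close>

lemma asc_moment_0_zero_left:
  fixes q :: real and t u :: complex
  assumes q: "\<bar>q\<bar> < 1" and t: "norm t < 1" and u: "norm u < 1"
  shows "asc_moment q 0 u 0 = qpoch q (t * u) * asc_moment q t u 0"
proof -
  let ?q = "complex_of_real q"
  have lt: "norm (?q ^ N * t) < 1" for N
  proof -
    have "norm (?q ^ N * t) \<le> 1 * norm t"
      unfolding norm_mult norm_power using q by (intro mult_right_mono power_le_one) auto
    then show ?thesis using t by simp
  qed
  have eq: "asc_moment q (?q ^ N * t) u 0 = (\<Prod>k<N. 1 - (t * u) * ?q ^ k) * asc_moment q t u 0" for N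
  proof (induction N)
    case (Suc N)
    have "asc_moment q (?q ^ Suc N * t) u 0 = asc_moment q (?q * (?q ^ N * t)) u 0"
      by (simp add: mult.assoc)
    also have "\<dots> = (1 - (?q ^ N * t) * u) * asc_moment q (?q ^ N * t) u 0"
      using asc_moment_shift[OF q lt u, of N 0] asc_moment_Suc_0[OF q lt u] by simp
    also have "\<dots> = (\<Prod>k<Suc N. 1 - (t * u) * ?q ^ k) * asc_moment q t u 0"
      unfolding Suc.IH prod.lessThan_Suc by (simp only: ac_simps)
    finally show ?case .
  qed simp
  have "continuous_on (ball 0 1) (\<lambda>t. asc_moment q t u 0)"
    by (rule continuous_on_asc_moment) (use q u in \<open>auto intro!: continuous_intros\<close>)
  moreover have "(\<lambda>N. ?q ^ N * t) \<longlonglongrightarrow> 0"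
    by (rule tendsto_mult_left_zero, rule LIMSEQ_power_zero) (use q in simp)
  ultimately have "(\<lambda>N. asc_moment q (?q ^ N * t) u 0) \<longlonglongrightarrow> asc_moment q 0 u 0"
    by (rule continuous_on_tendsto_compose) (use lt in auto)
  moreover have "(\<lambda>N. asc_moment q (?q ^ N * t) u 0) \<longlonglongrightarrow> qpoch q (t * u) * asc_moment q t u 0"
    unfolding eq by (intro tendsto_mult_right qpoch_LIMSEQ) (use q in simp)
  ultimately show ?thesis by (rule LIMSEQ_unique)
qed

lemma asc_moment_0_reduce:
  fixes q :: real and t u :: complex
  assumes q: "\<bar>q\<bar> < 1" and t: "norm t < 1" and u: "norm u < 1"
  shows "asc_moment q 0 0 0 = qpoch q (t * u) * asc_moment q t u 0"
  using asc_moment_0_zero_left[OF assms] asc_moment_0_zero_left[OF q u, of 0]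
    asc_moment_commute[of q u 0 0] by simp

section \<open>The total mass\<close>

text \<open>At \<open>t = u = 0\<close> the polynomials are the continuous \<open>q\<close>-Hermite
  polynomials. The factor \<open>qpoch q q\<close> makes the mass independent of the base.\<close>

definition hermite_mass :: "real \<Rightarrow> complex" where
  "hermite_mass q = qpoch q q * asc_moment q 0 0 0"

text \<open>For parameters \<open>s\<close> and \<open>- s\<close> with
  \<open>s\<^sup>2 = q\<close>, the denominator consists of the factorials of base
  \<open>q\<^sup>2\<close> at \<open>q z\<^sup>2\<close> and \<open>q / z\<^sup>2\<close>. These
  cancel the odd-index halves of the numerator and leave the parameter-free weight of base
  \<open>q\<^sup>2\<close>. The constant \<open>qpoch q (- q)\<close> merges with
  \<open>qpoch q q\<close> into \<open>qpoch (q\<^sup>2) (q\<^sup>2)\<close>.\<close>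

lemma hermite_mass_square:
  assumes q: "\<bar>q\<bar> < 1"
  shows "hermite_mass q = hermite_mass (q\<^sup>2)"
proof -
  let ?q = "complex_of_real q"
  \<comment> \<open>The complex root also covers negative \<open>q\<close>.\<close>
  define s where "s = csqrt ?q"
  have s2: "s\<^sup>2 = ?q" by (simp add: s_def)
  have nq: "norm ?q < 1" using q by simp
  have "norm s ^ 2 < 1" using q s2 by (metis norm_of_real norm_power)
  then have ns: "norm s < 1" by (simp add: power_less_one_iff)
  have nq2: "norm (?q\<^sup>2) < 1" using q by (simp add: norm_power abs_square_less_1)
  have "asc_moment q s (- s) 0 = asc_moment (?q\<^sup>2) 0 0 0"
    unfolding asc_moment_def
  proof (rule circ_int_cong)
    fix z :: complex assume z: "norm z = 1"
    have 1: "qpoch q (s * w) * qpoch q (- s * w) = qpoch (?q\<^sup>2) (?q * w\<^sup>2)" for w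
      using qpoch_mult_minus[OF nq, of "s * w"] s2 by (simp add: power_mult_distrib)
    have nz: "qpoch (?q\<^sup>2) (?q * z\<^sup>2) \<noteq> 0" "qpoch (?q\<^sup>2) (?q * inverse (z\<^sup>2)) \<noteq> 0"
      by (rule qpoch_nonzero[OF nq2]; use q z in \<open>simp add: norm_mult norm_inverse norm_power\<close>)+
    have "asc_weight q s (- s) z = qpoch q (z\<^sup>2) * qpoch q (inverse (z\<^sup>2)) /
        ((qpoch q (s * z) * qpoch q (- s * z)) * (qpoch q (s * inverse z) * qpoch q (- s * inverse z)))"
      by (simp add: asc_weight_def divide_inverse ac_simps)
    also have "\<dots> = asc_weight (?q\<^sup>2) 0 0 z"
      unfolding 1 power_inverse qpoch_even_odd[OF nq, of "z\<^sup>2"] qpoch_even_odd[OF nq, of "inverse (z\<^sup>2)"]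
      using nz unfolding asc_weight_def by (simp only: mult_zero_left div_0 qpoch_zero_right) simp
    finally show "asc_fun q s (- s) (z + inverse z) 0 * asc_weight q s (- s) z =
        asc_fun (?q\<^sup>2) 0 0 (z + inverse z) 0 * asc_weight (?q\<^sup>2) 0 0 z" by simp
  qed
  then have "asc_moment q 0 0 0 = qpoch q (- ?q) * asc_moment (?q\<^sup>2) 0 0 0"
    using asc_moment_0_reduce[OF q ns, of "- s"] ns s2 by (simp add: power2_eq_square)
  then show ?thesis
    using qpoch_mult_minus[OF nq, of ?q] by (simp add: hermite_mass_def mult.assoc)
qed

lemma hermite_mass_0: "hermite_mass 0 = 4 * of_real pi"
proof -
  \<comment> \<open>Passing to radius 1/2 multiplies the integral of \<open>z\<^sup>2\<close> by 1/4
    yet leaves it unchanged, so it vanishes.\<close>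
  have eq: "circ_int (\<lambda>z. (of_real (1 / 2) * z)\<^sup>2) = circ_int (\<lambda>z. z\<^sup>2)"
    by (rule circ_int_annulus[of "1 / 2" UNIV]) (auto intro!: holomorphic_intros)
  have z2: "circ_int (\<lambda>z. z\<^sup>2) = 0"
    using eq circ_int_mult[of "(of_real (1 / 2))\<^sup>2" "\<lambda>z. z\<^sup>2"]
    by (simp add: power_mult_distrib power_divide)
  have c: "continuous_on (sphere 0 1) (\<lambda>z::complex. (inverse z)\<^sup>2)"
    by (intro continuous_intros) auto
  have "asc_moment 0 0 0 0 = circ_int (\<lambda>z. 2 - (z\<^sup>2 + (inverse z)\<^sup>2))"
    unfolding asc_moment_def
  proof (rule circ_int_cong)
    fix z :: complex assume "norm z = 1"
    then have "z \<noteq> 0" by auto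
    then have "(1 - z\<^sup>2) * (1 - inverse (z\<^sup>2)) = 2 - (z\<^sup>2 + inverse (z\<^sup>2))"
      by (simp add: left_diff_distrib right_diff_distrib)
    then show "asc_fun 0 0 0 (z + inverse z) 0 * asc_weight 0 0 0 z = 2 - (z\<^sup>2 + (inverse z)\<^sup>2)"
      by (simp add: asc_weight_def power_inverse)
  qed
  also have "\<dots> = circ_int (\<lambda>z. 2) - (circ_int (\<lambda>z. z\<^sup>2) + circ_int (\<lambda>z. (inverse z)\<^sup>2))"
    by (subst circ_int_diff, (intro continuous_intros c)+, subst circ_int_add)
       (intro continuous_intros c refl)+
  also have "circ_int (\<lambda>z. (inverse z)\<^sup>2) = 0"
    using z2 circ_int_inverse[of "\<lambda>z. z\<^sup>2"] by simp
  finally show ?thesis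
    using z2 by (simp add: hermite_mass_def circ_int_def scaleR_conv_of_real)
qed

lemma hermite_mass_eq:
  assumes q: "\<bar>q\<bar> < 1"
  shows "hermite_mass q = 4 * of_real pi"
proof -
  have lt: "\<bar>q ^ (2 ^ n)\<bar> < 1" for n
    using q by (simp add: power_abs power_less_one_iff)
  have "hermite_mass (q ^ (2 ^ n)) = hermite_mass q" for n
  proof (induction n)
    case (Suc n)
    have "hermite_mass (q ^ (2 ^ Suc n)) = hermite_mass ((q ^ (2 ^ n))\<^sup>2)"
      by (simp add: power_mult[symmetric] mult.commute)
    with Suc hermite_mass_square[OF lt[of n]] show ?case by simp
  qed simp
  moreover have "continuous_on (ball 0 1) hermite_mass"
    unfolding hermite_mass_def [abs_def]
    by (intro continuous_intros continuous_on_asc_moment) auto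
  moreover have "(\<lambda>n. q ^ (2 ^ n)) \<longlonglongrightarrow> 0"
    using LIMSEQ_subseq_LIMSEQ[OF LIMSEQ_power_zero[of q], of "\<lambda>n. 2 ^ n"] q
    by (simp add: strict_mono_def o_def)
  ultimately have "(\<lambda>n::nat. hermite_mass q) \<longlonglongrightarrow> hermite_mass 0"
    using continuous_on_tendsto_compose[of "ball 0 1" hermite_mass "\<lambda>n. q ^ (2 ^ n)" 0 sequentially] lt
    by simp
  then show ?thesis by (simp add: LIMSEQ_const_iff hermite_mass_0)
qed

lemma asc_moment_0:
  fixes q :: real and t u :: complex
  assumes "\<bar>q\<bar> < 1" "norm t < 1" "norm u < 1"
  shows "qpoch q (t * u) * qpoch q q * asc_moment q t u 0 = 4 * of_real pi"
  using hermite_mass_eq[OF assms(1)] asc_moment_0_reduce[OF assms]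
  by (simp add: hermite_mass_def ac_simps)

section \<open>The density\<close>

text \<open>Here \<open>w\<close> stands for \<open>1/z\<close>. For \<open>r = aroot\<close>,
  \<open>r' = cnj aroot\<close>, \<open>p = q ^ k\<close> and \<open>z + w = qscale * x\<close>, the
  right side is \<open>asc_denominator\<close>.\<close>

lemma denominator_factorization:
  fixes z w r r' p :: complex
  assumes "z * w = 1"
  shows "(1 - r * z * p) * (1 - r * w * p) * ((1 - r' * z * p) * (1 - r' * w * p)) =
    (1 - r * r' * p\<^sup>2)\<^sup>2 - (r + r') * (z + w) * p * (1 + r * r' * p\<^sup>2)
      + (r * r' * (z + w)\<^sup>2 + (r + r')\<^sup>2) * p\<^sup>2"
  using assms by algebra

lemma numerator_factorization:
  fixes z w p :: complex
  assumes "z * w = 1"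
  shows "(1 - z\<^sup>2 * p) * (1 - w\<^sup>2 * p) = (1 + p)\<^sup>2 - (z + w)\<^sup>2 * p"
  using assms by algebra

lemma asc_weight_inverse: "asc_weight q t u (inverse z) = asc_weight q t u z"
  by (simp add: asc_weight_def power_inverse divide_inverse ac_simps)

locale asc_params =
  fixes q a b :: real
  assumes q: "\<bar>q\<bar> < 1" and b: "0 < b" "b < 1" and ab: "a\<^sup>2 * (1 - q) < 4 * b"
begin

definition qscale :: real where "qscale = sqrt (1 - q)"

text \<open>The hypothesis \<open>a\<^sup>2 (1 - q) < 4 b\<close> makes the real square root below genuine.\<close>

definition aroot :: complex where
  "aroot = Complex (a * qscale / 2) (sqrt (b - (a * qscale / 2)\<^sup>2))"

lemma qscale_pos: "0 < qscale" and qscale_square: "qscale\<^sup>2 = 1 - q"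
  using q by (auto simp: qscale_def)

lemma aroot_add: "aroot + cnj aroot = of_real (a * qscale)"
  by (simp add: aroot_def complex_eq_iff)

lemma aroot_mult: "aroot * cnj aroot = of_real b"
proof -
  have "(a * qscale / 2)\<^sup>2 \<le> b"
    using ab by (simp add: power_mult_distrib power_divide qscale_square)
  then show ?thesis
    by (simp add: complex_mult_cnj aroot_def)
qed

lemma norm_aroot: "norm aroot < 1"
proof -
  have "complex_of_real ((norm aroot)\<^sup>2) = of_real b"
    by (simp only: complex_norm_square aroot_mult)
  then have "(norm aroot)\<^sup>2 = b" by (simp only: of_real_eq_iff)
  then show ?thesis using b by (metis abs_norm_cancel abs_square_less_1)
qed

lemma norm_cnj_aroot: "norm (cnj aroot) < 1"
  using norm_aroot by simp

lemma norm_q: "norm (complex_of_real q) < 1"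
  using q by simp

lemma asc_fun_eq_poly:
  "asc_fun q aroot (cnj aroot) (of_real (qscale * x)) n = of_real (qscale ^ n * poly (al_salam_chihara q a b n) x)"
proof (induction n rule: induct_nat_012)
  case 1
  then show ?case by (simp only: asc_fun.simps aroot_add) (simp add: algebra_simps)
next
  case (ge2 n)
  \<comment> \<open>Multiplying the bracket by \<open>1 - q\<close> yields the corresponding factor
    of \<open>asc_fun\<close>; this absorbs two powers of \<open>qscale\<close>.\<close>
  have br: "1 - q ^ Suc n = qscale\<^sup>2 * q_bracket q (Suc n)"
    unfolding qscale_square q_bracket_def by (rule one_diff_power_eq)
  have "asc_fun q aroot (cnj aroot) (of_real (qscale * x)) (Suc (Suc n)) =
    of_real ((qscale * x - a * qscale * q ^ Suc n) * (qscale ^ Suc n * poly (al_salam_chihara q a b (Suc n)) x)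
      - (1 - b * q ^ n) * (1 - q ^ Suc n) * (qscale ^ n * poly (al_salam_chihara q a b n) x))"
    unfolding asc_fun.simps aroot_add aroot_mult ge2
    by (simp only: of_real_mult of_real_diff of_real_power of_real_1)
  also have "(qscale * x - a * qscale * q ^ Suc n) * (qscale ^ Suc n * poly (al_salam_chihara q a b (Suc n)) x)
      - (1 - b * q ^ n) * (1 - q ^ Suc n) * (qscale ^ n * poly (al_salam_chihara q a b n) x)
     = qscale ^ Suc (Suc n) * poly (al_salam_chihara q a b (Suc (Suc n))) x"
    unfolding br by (simp add: algebra_simps power2_eq_square)
  finally show ?case .
qed simp

text \<open>The complex number is real, being an infinite product of real factors by
  \<open>of_real_prodinf_asc_factor\<close>; \<open>Re\<close> only changes the type.\<close>

definition circle_density :: "real \<Rightarrow> real" where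
  "circle_density \<theta> = Re (qpoch q b * qpoch q q * asc_weight q aroot (cnj aroot) (cis \<theta>))"

context
  fixes \<theta> x :: real
  assumes x: "qscale * x = 2 * cos \<theta>"
begin

lemma cis_add_inverse: "cis \<theta> + inverse (cis \<theta>) = of_real (qscale * x)"
  by (simp add: x complex_eq_iff)

lemma cis_mult_inverse: "cis \<theta> * inverse (cis \<theta>) = 1"
  by (rule right_inverse) (rule cis_neq_zero)

lemma x_square: "(1 - q) * x\<^sup>2 = (qscale * x)\<^sup>2"
  by (simp add: power_mult_distrib qscale_square)

lemma of_real_asc_denominator:
  "complex_of_real (asc_denominator q a b x k) =
     (1 - aroot * cis \<theta> * of_real q ^ k) * (1 - aroot * inverse (cis \<theta>) * of_real q ^ k) *
     ((1 - cnj aroot * cis \<theta> * of_real q ^ k) * (1 - cnj aroot * inverse (cis \<theta>) * of_real q ^ k))"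
proof -
  have "asc_denominator q a b x k = (1 - b * (q ^ k)\<^sup>2)\<^sup>2 - (a * qscale) * (qscale * x) * q ^ k * (1 + b * (q ^ k)\<^sup>2)
      + (b * (qscale * x)\<^sup>2 + (a * qscale)\<^sup>2) * (q ^ k)\<^sup>2"
    unfolding asc_denominator_def power_mult_distrib qscale_square power_mult[of q 2 k, unfolded power2_eq_square[of q]]
    by (simp add: qscale_square[symmetric] power2_eq_square algebra_simps power_mult_distrib)
  then show ?thesis
    unfolding denominator_factorization[OF cis_mult_inverse] aroot_mult aroot_add cis_add_inverse by simp
qed

text \<open>The four linear factors form two conjugate pairs, so the denominator is a product of
  squared moduli, nonzero because \<open>norm aroot < 1\<close>.\<close>

lemma asc_denominator_pos: "0 < asc_denominator q a b x k"
proof -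
  have nz: "1 - c * w * of_real q ^ k \<noteq> 0" if "norm c < 1" "norm w = 1" for c w :: complex
  proof -
    have "norm c * \<bar>q\<bar> ^ k \<le> norm c * 1" using q by (intro mult_left_mono power_le_one) auto
    then have "norm (c * w * of_real q ^ k) < 1"
      using that by (simp add: norm_mult norm_power)
    then show ?thesis by (rule one_minus_nonzero)
  qed
  let ?u = "1 - aroot * cis \<theta> * of_real q ^ k" and ?v = "1 - aroot * inverse (cis \<theta>) * of_real q ^ k"
  have c: "cnj ?u = 1 - cnj aroot * inverse (cis \<theta>) * of_real q ^ k"
    "cnj ?v = 1 - cnj aroot * cis \<theta> * of_real q ^ k"
    by (simp_all add: cis_cnj cis_inverse)
  have "complex_of_real (asc_denominator q a b x k) = (?u * cnj ?u) * (?v * cnj ?v)"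
    unfolding of_real_asc_denominator c by (simp only: ac_simps)
  also have "\<dots> = of_real ((norm ?u)\<^sup>2 * (norm ?v)\<^sup>2)"
    by (simp only: complex_norm_square of_real_mult)
  finally have "asc_denominator q a b x k = (norm ?u)\<^sup>2 * (norm ?v)\<^sup>2"
    by (simp only: of_real_eq_iff)
  then show ?thesis
    using nz[OF norm_aroot, of "cis \<theta>"] nz[OF norm_aroot, of "inverse (cis \<theta>)"] by (simp add: norm_inverse)
qed

lemma asc_factor_nonneg: "0 \<le> asc_factor q a b x k"
proof -
  have qk: "\<bar>q ^ k\<bar> \<le> 1" for k using q by (simp add: power_abs power_le_one)
  have "b * q ^ k \<le> b * 1" using b qk[of k] by (intro mult_left_mono) auto
  also have "\<dots> \<le> 1" using b by simp
  finally have "b * q ^ k \<le> 1" .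
  moreover have "q ^ (k + 1) \<le> 1" using qk[of "k + 1"] by simp
  \<comment> \<open>Since \<open>(qscale * x)\<^sup>2 \<le> 4\<close>, the case
    \<open>q ^ k \<ge> 0\<close> reduces to \<open>4 p \<le> (1 + p)\<^sup>2\<close>; negative
    \<open>q ^ k\<close>, possible for \<open>q < 0\<close>, is settled by the sign.\<close>
  moreover have "(qscale * x)\<^sup>2 * q ^ k \<le> (1 + q ^ k)\<^sup>2"
  proof (cases "0 \<le> q ^ k")
    case True
    have "(qscale * x)\<^sup>2 * q ^ k \<le> 4 * q ^ k"
      unfolding x using True by (intro mult_right_mono) (auto simp: power_mult_distrib abs_square_le_1)
    also have "\<dots> \<le> 4 * q ^ k + (1 - q ^ k)\<^sup>2" by simp
    also have "\<dots> = (1 + q ^ k)\<^sup>2" by (simp add: power2_eq_square algebra_simps)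
    finally show ?thesis .
  next
    case False
    then have "(qscale * x)\<^sup>2 * q ^ k \<le> 0" by (simp add: mult_nonneg_nonpos)
    then show ?thesis using zero_le_power2 order_trans by blast
  qed
  ultimately show ?thesis
    unfolding asc_factor_def x_square
    using asc_denominator_pos[of k] by (intro divide_nonneg_pos mult_nonneg_nonneg) auto
qed

text \<open>The two factorization lemmas write each factor through the factors of index
  \<open>k\<close> of eight factorials. \<open>has_prod\<close> admits zero factors, which occur for
  instance at \<open>\<theta> = 0\<close>.\<close>

lemma of_real_asc_factor_has_prod:
  "(\<lambda>k. complex_of_real (asc_factor q a b x k)) has_prod
     (qpoch q b * qpoch q q * asc_weight q aroot (cnj aroot) (cis \<theta>))"
proof -
  let ?z = "cis \<theta>" and ?w = "inverse (cis \<theta>)" and ?q = "complex_of_real q"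
  note hp = has_prod_qpoch[OF norm_q]
  have num: "complex_of_real ((1 + q ^ k)\<^sup>2 - (1 - q) * x\<^sup>2 * q ^ k) = (1 - ?z\<^sup>2 * ?q ^ k) * (1 - ?w\<^sup>2 * ?q ^ k)" for k
    unfolding x_square numerator_factorization[OF cis_mult_inverse] cis_add_inverse by simp
  have "(\<lambda>k. (1 - of_real b * ?q ^ k) * (1 - ?q * ?q ^ k) * ((1 - ?z\<^sup>2 * ?q ^ k) * (1 - ?w\<^sup>2 * ?q ^ k)) /
     ((1 - aroot * ?z * ?q ^ k) * (1 - aroot * ?w * ?q ^ k) *
     ((1 - cnj aroot * ?z * ?q ^ k) * (1 - cnj aroot * ?w * ?q ^ k))))
    has_prod (qpoch q b * qpoch q q * (qpoch q (?z\<^sup>2) * qpoch q (?w\<^sup>2)) /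
      (qpoch q (aroot * ?z) * qpoch q (aroot * ?w) * (qpoch q (cnj aroot * ?z) * qpoch q (cnj aroot * ?w))))"
    by (intro has_prod_divide has_prod_mult hp)
  also have "qpoch q b * qpoch q q * (qpoch q (?z\<^sup>2) * qpoch q (?w\<^sup>2)) /
      (qpoch q (aroot * ?z) * qpoch q (aroot * ?w) * (qpoch q (cnj aroot * ?z) * qpoch q (cnj aroot * ?w))) =
     qpoch q b * qpoch q q * asc_weight q aroot (cnj aroot) (cis \<theta>)"
    by (simp only: asc_weight_def divide_inverse power_inverse ac_simps)
  finally show ?thesis
    unfolding asc_factor_def of_real_divide of_real_mult num of_real_asc_denominator by simp
qed

lemma convergent_prod_asc_factor: "convergent_prod (asc_factor q a b x)"
proof -
  have "convergent_prod (complex_of_real \<circ> asc_factor q a b x)"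
    using of_real_asc_factor_has_prod unfolding comp_def has_prod_iff by blast
  then show ?thesis by (simp only: convergent_prod_of_real_iff)
qed

lemma of_real_prodinf_asc_factor:
  "complex_of_real (prodinf (asc_factor q a b x)) = qpoch q b * qpoch q q * asc_weight q aroot (cnj aroot) (cis \<theta>)"
proof -
  have "(\<lambda>k. complex_of_real (asc_factor q a b x k)) has_prod of_real (prodinf (asc_factor q a b x))"
    unfolding has_prod_of_real_iff by (rule convergent_prod_has_prod[OF convergent_prod_asc_factor])
  then show ?thesis
    using of_real_asc_factor_has_prod has_prod_unique2 by blast
qed

lemma prodinf_asc_factor: "prodinf (asc_factor q a b x) = circle_density \<theta>"
  unfolding circle_density_def of_real_prodinf_asc_factor[symmetric] by simp

lemma prodinf_asc_factor_nonneg: "0 \<le> prodinf (asc_factor q a b x)"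
  using has_prod_nonneg[OF convergent_prod_has_prod[OF convergent_prod_asc_factor]] asc_factor_nonneg
  by blast

end

section \<open>Transfer of integrals from the line to the circle\<close>

lemma support_iff: "x\<^sup>2 < 4 / (1 - q) \<longleftrightarrow> \<bar>qscale * x / 2\<bar> < 1"
proof -
  have "x\<^sup>2 < 4 / (1 - q) \<longleftrightarrow> (qscale * x / 2)\<^sup>2 < 1"
    using q by (simp add: power_mult_distrib power_divide qscale_square field_simps)
  then show ?thesis by (simp only: abs_square_less_1)
qed

lemma support_param:
  assumes "x\<^sup>2 < 4 / (1 - q)"
  obtains \<theta> where "0 < \<theta>" "\<theta> < pi" "qscale * x = 2 * cos \<theta>"
proof
  let ?\<theta> = "arccos (qscale * x / 2)"
  have 1: "- 1 < qscale * x / 2" "qscale * x / 2 < 1"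
    using assms unfolding support_iff abs_less_iff by linarith+
  show "0 < ?\<theta>" "?\<theta> < pi" using arccos_lt_bounded[OF 1] by auto
  show "qscale * x = 2 * cos ?\<theta>" using 1 by simp
qed

lemma asc_density_nonneg: "0 \<le> asc_density q a b x"
proof (cases "x\<^sup>2 < 4 / (1 - q)")
  case True
  then obtain \<theta> where \<theta>: "qscale * x = 2 * cos \<theta>" by (rule support_param)
  have "(1 - q) * x\<^sup>2 \<le> 4" using True q by (simp add: field_simps)
  then show ?thesis
    using True q prodinf_asc_factor_nonneg[OF \<theta>]
    by (simp add: asc_density_def)
qed (simp add: asc_density_def)

text \<open>The Jacobian of \<open>x = 2 * cos \<theta> / qscale\<close> cancels the square root,
  which equals \<open>2 * sin \<theta>\<close> on the open half circle.\<close>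

lemma asc_density_cos:
  assumes \<theta>: "0 < \<theta>" "\<theta> < pi"
  shows "\<bar>- (2 * sin \<theta> / qscale)\<bar> * asc_density q a b (2 * cos \<theta> / qscale) = circle_density \<theta> / (2 * pi)"
proof -
  define x where "x = 2 * cos \<theta> / qscale"
  have x: "qscale * x = 2 * cos \<theta>" using qscale_pos by (simp add: x_def)
  have sin: "0 < sin \<theta>" using \<theta> by (rule sin_gt_zero)
  have "(sin \<theta>)\<^sup>2 > 0" using sin by simp
  then have "(cos \<theta>)\<^sup>2 < 1" using sin_cos_squared_add[of \<theta>] by linarith
  then have "\<bar>cos \<theta>\<bar> < 1" by (simp only: abs_square_less_1)
  then have supp: "x\<^sup>2 < 4 / (1 - q)" unfolding support_iff x by simp
  have "4 - (1 - q) * x\<^sup>2 = (2 * sin \<theta>)\<^sup>2"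
    unfolding x_square[OF x] x by (simp add: power_mult_distrib sin_squared_eq)
  then have "sqrt (4 - (1 - q) * x\<^sup>2) = \<bar>2 * sin \<theta>\<bar>" by (simp only: real_sqrt_abs)
  then have "sqrt (4 - (1 - q) * x\<^sup>2) = 2 * sin \<theta>" using sin by simp
  then have "asc_density q a b x = qscale / (2 * pi * (2 * sin \<theta>)) * circle_density \<theta>"
    using supp prodinf_asc_factor[OF x] by (simp add: asc_density_def qscale_def)
  then show ?thesis
    using sin qscale_pos unfolding x_def[symmetric] by (simp add: field_simps abs_mult)
qed

text \<open>The density is the pointwise limit of its finite products; off the support all terms are
  0.\<close>

lemma measurable_asc_density [measurable]: "asc_density q a b \<in> borel_measurable borel"
proof (rule borel_measurable_LIMSEQ_real)
  let ?u = "\<lambda>n x. if x\<^sup>2 < 4 / (1 - q) then sqrt (1 - q) / (2 * pi * sqrt (4 - (1 - q) * x\<^sup>2)) *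
      (\<Prod>k\<le>n. asc_factor q a b x k) else 0"
  show "?u n \<in> borel_measurable borel" for n
    unfolding asc_factor_def asc_denominator_def by measurable
  fix x :: real
  show "(\<lambda>n. ?u n x) \<longlonglongrightarrow> asc_density q a b x"
  proof (cases "x\<^sup>2 < 4 / (1 - q)")
    case True
    then obtain \<theta> where "qscale * x = 2 * cos \<theta>" by (rule support_param)
    then show ?thesis
      unfolding asc_density_def if_P[OF True]
      by (intro tendsto_mult_left convergent_prod_LIMSEQ convergent_prod_asc_factor)
  qed (simp add: asc_density_def)
qed

lemma continuous_circle_density: "continuous_on A circle_density"
  unfolding circle_density_def [abs_def]
  by (intro continuous_intros) (use norm_aroot norm_q in auto)

lemma circle_density_minus: "circle_density (- \<theta>) = circle_density \<theta>"
  unfolding circle_density_def by (simp flip: cis_inverse add: asc_weight_inverse)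

text \<open>A change of variables leads to the open half circle. The integrand is even in
  \<open>\<theta>\<close>, so doubling the interval turns \<open>2 * pi\<close> into
  \<open>4 * pi\<close>.\<close>

lemma asc_density_integral:
  fixes f :: "real \<Rightarrow> real"
  assumes f: "continuous_on UNIV f"
  shows "integrable lborel (\<lambda>x. asc_density q a b x * f x)" (is ?A)
    and "(\<integral>x. asc_density q a b x * f x \<partial>lborel) =
      integral {- pi..pi} (\<lambda>\<theta>. circle_density \<theta> * f (2 * cos \<theta> / qscale)) / (4 * pi)" (is ?B)
proof -
  let ?F = "\<lambda>x. asc_density q a b x * f x" and ?S = "{0<..<pi}"
    and ?g = "\<lambda>\<theta>. 2 * cos \<theta> / qscale" and ?g' = "\<lambda>\<theta>. - (2 * sin \<theta> / qscale)"
  let ?H = "\<lambda>\<theta>. circle_density \<theta> * f (?g \<theta>)"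
  have contH: "continuous_on A ?H" for A
    by (intro continuous_intros continuous_circle_density continuous_on_compose2[OF f])
       (use qscale_pos in auto)
  have H: "\<bar>?g' \<theta>\<bar> * ?F (?g \<theta>) = ?H \<theta> / (2 * pi)" if "\<theta> \<in> ?S" for \<theta>
    using asc_density_cos[of \<theta>] that by (simp add: mult.assoc[symmetric])
  have "(\<lambda>\<theta>. ?H \<theta> / (2 * pi)) absolutely_integrable_on {0..pi}"
    by (intro absolutely_integrable_continuous_real continuous_intros contH) auto
  then have "(\<lambda>\<theta>. ?H \<theta> / (2 * pi)) absolutely_integrable_on ?S"
    by (rule set_integrable_subset) auto
  moreover have "(\<lambda>\<theta>. \<bar>?g' \<theta>\<bar> * ?F (?g \<theta>)) absolutely_integrable_on ?S \<longleftrightarrow>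
      (\<lambda>\<theta>. ?H \<theta> / (2 * pi)) absolutely_integrable_on ?S"
    by (rule set_integrable_cong[OF refl refl H])
  ultimately have "(\<lambda>\<theta>. \<bar>?g' \<theta>\<bar> * ?F (?g \<theta>)) absolutely_integrable_on ?S"
    by (simp only:)
  moreover have "integral ?S (\<lambda>\<theta>. \<bar>?g' \<theta>\<bar> * ?F (?g \<theta>)) = integral {0..pi} ?H / (2 * pi)"
    by (subst Henstock_Kurzweil_Integration.integral_cong[OF H]) (auto simp: integral_open_interval_real)
  ultimately have "?F absolutely_integrable_on (?g ` ?S) \<and> integral (?g ` ?S) ?F = integral {0..pi} ?H / (2 * pi)"
  proof (subst has_absolute_integral_change_of_variables_1'[symmetric, where g' = ?g'])
    show "inj_on ?g ?S"
      using qscale_pos by (auto simp: inj_on_def intro: cos_inj_pi)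
    show "(?g has_field_derivative ?g' \<theta>) (at \<theta> within ?S)" for \<theta>
      using qscale_pos by (auto intro!: derivative_eq_intros)
  qed auto
  then have F: "?F absolutely_integrable_on (?g ` ?S)"
    and FI: "integral (?g ` ?S) ?F = integral {0..pi} ?H / (2 * pi)" by auto
  have out: "?F x = 0" if "x \<notin> ?g ` ?S" for x
  proof -
    have "\<not> x\<^sup>2 < 4 / (1 - q)"
    proof
      assume "x\<^sup>2 < 4 / (1 - q)"
      then obtain \<theta> where "\<theta> \<in> ?S" "qscale * x = 2 * cos \<theta>" by (rule support_param) auto
      then have "x = ?g \<theta>" using qscale_pos by (simp add: field_simps)
      with \<open>\<theta> \<in> ?S\<close> that show False by blast
    qed
    then show ?thesis by (simp add: asc_density_def)
  qed
  have meas: "?F \<in> borel_measurable lborel"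
    using borel_measurable_continuous_onI[OF f] by measurable
  have "(\<lambda>x. indicator (?g ` ?S) x *\<^sub>R ?F x) = ?F"
    using out by (auto simp: indicator_def fun_eq_iff)
  \<comment> \<open>The change of variables yields integrability for Lebesgue measure; Borel
    measurability carries it over to \<open>lborel\<close>.\<close>
  with F have "integrable lebesgue ?F" by (simp add: set_integrable_def)
  then show int: ?A using integrable_completion[OF meas] by simp
  have "(\<integral>x. ?F x \<partial>lborel) = integral UNIV ?F" using integral_lborel[OF int] by simp
  also have "\<dots> = integral UNIV (\<lambda>x. if x \<in> ?g ` ?S then ?F x else 0)"
    using out by (intro arg_cong2[where f = integral]) auto
  also have "\<dots> = integral {0..pi} ?H / (2 * pi)"
    unfolding integral_restrict_UNIV by (rule FI)
  finally have I: "(\<integral>x. ?F x \<partial>lborel) = integral {0..pi} ?H / (2 * pi)" .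
  have "integral {- pi..0} ?H + integral {0..pi} ?H = integral {- pi..pi} ?H"
    by (rule Henstock_Kurzweil_Integration.integral_combine) (auto intro!: integrable_continuous_interval contH)
  moreover have "integral {- pi..0} ?H = integral {0..pi} ?H"
    using Henstock_Kurzweil_Integration.integral_reflect_real[of pi 0 ?H] by (simp add: circle_density_minus)
  ultimately show ?B unfolding I by (simp add: field_simps)
qed

text \<open>Up to a power of \<open>qscale\<close> this is the real part of \<open>J_n\<close> times
  the constant factorials; the total mass \<open>4 * pi\<close> cancels the denominator in
  \<open>asc_density_integral\<close>.\<close>

lemma asc_density_poly_integral:
  "(\<integral>x. asc_density q a b x * poly (al_salam_chihara q a b n) x \<partial>lborel) = (if n = 0 then 1 else 0)"
proof -
  let ?p = "poly (al_salam_chihara q a b n)"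
  let ?c = "qpoch q b * qpoch q q"
  let ?m = "\<lambda>\<theta>. ?c * (asc_fun q aroot (cnj aroot) (cis \<theta> + inverse (cis \<theta>)) n * asc_weight q aroot (cnj aroot) (cis \<theta>))"
  have "continuous_on (sphere 0 1) (\<lambda>z. ?c * (asc_fun q aroot (cnj aroot) (z + inverse z) n * asc_weight q aroot (cnj aroot) z))"
    by (intro continuous_intros) (use norm_aroot norm_q in auto)
  from integrable_circ[OF this]
  have int: "?m integrable_on {- pi..pi}" .
  have eq: "qscale ^ n * (circle_density \<theta> * ?p (2 * cos \<theta> / qscale)) = Re (?m \<theta>)" for \<theta>
  proof -
    have x: "qscale * (2 * cos \<theta> / qscale) = 2 * cos \<theta>" using qscale_pos by simp
    have "?m \<theta> = of_real (qscale ^ n * ?p (2 * cos \<theta> / qscale)) * (?c * asc_weight q aroot (cnj aroot) (cis \<theta>))"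
      unfolding cis_add_inverse[OF x] asc_fun_eq_poly by (simp only: ac_simps)
    moreover have "Re (of_real c * y) = c * Re y" for c y by simp
    ultimately have "Re (?m \<theta>) = (qscale ^ n * ?p (2 * cos \<theta> / qscale)) * circle_density \<theta>"
      unfolding circle_density_def by (simp only:)
    then show ?thesis by (simp only: mult_ac)
  qed
  have "qscale ^ n * (\<integral>x. asc_density q a b x * ?p x \<partial>lborel) = integral {- pi..pi} (\<lambda>\<theta>. Re (?m \<theta>)) / (4 * pi)"
    unfolding eq[symmetric] by (subst asc_density_integral(2)) (auto intro!: continuous_intros)
  also have "integral {- pi..pi} (\<lambda>\<theta>. Re (?m \<theta>)) = Re (integral {- pi..pi} ?m)"
    using integral_linear[OF int bounded_linear_Re] by (simp add: o_def)
  also have "integral {- pi..pi} ?m = ?c * asc_moment q aroot (cnj aroot) n"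
    by (simp add: asc_moment_def circ_int_def)
  also have "\<dots> = (if n = 0 then 4 * pi else 0)"
  proof (cases n)
    case 0
    then show ?thesis using asc_moment_0[OF q norm_aroot norm_cnj_aroot] unfolding aroot_mult by simp
  next
    case (Suc m)
    then show ?thesis using asc_moment_Suc[OF q norm_aroot norm_cnj_aroot] by simp
  qed
  finally show ?thesis using qscale_pos by (auto split: if_splits)
qed

end

section \<open>Orthogonality and uniqueness\<close>

lemma coeff_al_salam_chihara:
  "(\<forall>i>n. coeff (al_salam_chihara q a b n) i = 0) \<and> coeff (al_salam_chihara q a b n) n = 1"
proof (induction n rule: induct_nat_012)
  case 1
  then show ?case by (auto simp: coeff_pCons split: nat.splits)
next
  case (ge2 n)
  then show ?case by (auto simp: coeff_pCons split: nat.splits)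
qed simp

lemma al_salam_chihara_recurrence:
  "x * poly (al_salam_chihara q a b (Suc n)) x =
    poly (al_salam_chihara q a b (Suc (Suc n))) x + a * q ^ Suc n * poly (al_salam_chihara q a b (Suc n)) x
    + (1 - b * q ^ n) * q_bracket q (Suc n) * poly (al_salam_chihara q a b n) x"
  by (simp add: algebra_simps)

text \<open>Orthogonality to \<open>p 0 = 1\<close> fixes the integral of every \<open>p n\<close>,
  and the monic \<open>p n\<close> span all polynomials.\<close>

lemma orthogonality_distribution_poly_integrals:
  assumes M: "is_orthogonality_distribution M p" and N: "is_orthogonality_distribution N p"
    and p0: "p 0 = 1"
    and monic: "\<And>n. (\<forall>i>n. coeff (p n) i = 0) \<and> coeff (p n) n = 1"
  shows "integrable M (poly f) \<and> integrable N (poly f) \<and> integral\<^sup>L M (poly f) = integral\<^sup>L N (poly f)"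
proof -
  interpret M: prob_space M using M by (simp add: is_orthogonality_distribution_def)
  interpret N: prob_space N using N by (simp add: is_orthogonality_distribution_def)
  have int: "integrable M (poly (p n))" "integrable N (poly (p n))" for n
  proof -
    have "integrable M (\<lambda>x. poly (p n) x * poly (p 0) x)" "integrable N (\<lambda>x. poly (p n) x * poly (p 0) x)"
      using M N unfolding is_orthogonality_distribution_def by blast+
    then show "integrable M (poly (p n))" "integrable N (poly (p n))" by (simp_all add: p0)
  qed
  have eq: "integral\<^sup>L M (poly (p n)) = integral\<^sup>L N (poly (p n))" for n
  proof (cases "n = 0")
    case True
    have "poly (p 0) = (\<lambda>x. 1)" by (simp add: p0 fun_eq_iff)
    with True show ?thesis by (simp add: M.prob_space N.prob_space)
  next
    case False
    then have "(\<integral>x. poly (p n) x * poly (p 0) x \<partial>M) = 0" "(\<integral>x. poly (p n) x * poly (p 0) x \<partial>N) = 0"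
      using M N unfolding is_orthogonality_distribution_def by blast+
    then show ?thesis by (simp add: p0)
  qed
  \<comment> \<open>The induction is on a bound for the number of coefficients, so it starts at the
    zero polynomial; subtracting a multiple of \<open>p n\<close> removes the top
    coefficient.\<close>
  have "integrable M (poly f) \<and> integrable N (poly f) \<and> integral\<^sup>L M (poly f) = integral\<^sup>L N (poly f)"
    if "\<forall>i\<ge>n. coeff f i = 0" for n f
    using that
  proof (induction n arbitrary: f)
    case 0
    then have "f = 0" by (simp add: poly_eq_iff)
    then show ?case by simp
  next
    case (Suc n)
    let ?c = "coeff f n"
    define g where "g = f - smult ?c (p n)"
    have "\<forall>i\<ge>n. coeff g i = 0"
    proof (intro allI impI)
      fix i assume "n \<le> i"
      then consider "i = n" | "Suc n \<le> i" by linarith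
      then show "coeff g i = 0"
        using Suc.prems monic[of n] by cases (simp_all add: g_def)
    qed
    note IH = Suc.IH[OF this]
    have f: "poly f = (\<lambda>x. poly g x + ?c * poly (p n) x)"
      by (simp add: g_def fun_eq_iff)
    show ?case
      unfolding f using IH int[of n] eq[of n] by simp
  qed
  from this[of "Suc (degree f)" f] show ?thesis by (simp add: coeff_eq_0)
qed

section \<open>Determinacy by geometrically bounded even moments\<close>

lemma (in real_distribution) char_bound_even:
  fixes C :: real
  assumes int: "\<And>k. integrable M (\<lambda>x. x ^ k)" and bound: "expectation (\<lambda>x. x ^ (2 * m)) \<le> C ^ m"
  shows "cmod (char M t - (\<Sum>k\<le>2 * m. ((\<i> * t) ^ k / fact k) * expectation (\<lambda>x. x ^ k)))
    \<le> 2 * (t\<^sup>2 * C) ^ m / fact (2 * m)"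
proof -
  have "cmod (char M t - (\<Sum>k\<le>2 * m. ((\<i> * t) ^ k / fact k) * expectation (\<lambda>x. x ^ k)))
      \<le> (2 * \<bar>t\<bar> ^ (2 * m) / fact (2 * m)) * expectation (\<lambda>x. \<bar>x\<bar> ^ (2 * m))"
    by (rule char_approx1) (rule int)
  \<comment> \<open>Because the order is even, the absolute moment in the Taylor remainder is an
    ordinary moment.\<close>
  also have "\<dots> = (2 * (t\<^sup>2) ^ m / fact (2 * m)) * expectation (\<lambda>x. x ^ (2 * m))"
    by (simp add: power_mult)
  also have "\<dots> \<le> (2 * (t\<^sup>2) ^ m / fact (2 * m)) * C ^ m"
    by (intro mult_left_mono bound) simp
  also have "\<dots> = 2 * (t\<^sup>2 * C) ^ m / fact (2 * m)"
    by (simp add: power_mult_distrib)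
  finally show ?thesis .
qed

text \<open>Both characteristic functions are approximated by the same Taylor polynomials with an
  error tending to 0. A bound for \<open>N\<close> serves both, as the moments agree.\<close>

lemma real_distribution_eq_of_moments:
  fixes C :: real
  assumes M: "real_distribution M" and N: "real_distribution N"
    and int: "\<And>k. integrable M (\<lambda>x. x ^ k)" "\<And>k. integrable N (\<lambda>x. x ^ k)"
    and eq: "\<And>k. (\<integral>x. x ^ k \<partial>M) = (\<integral>x. x ^ k \<partial>N)"
    and bound: "\<And>m. (\<integral>x. x ^ (2 * m) \<partial>N) \<le> C ^ m" and C: "0 \<le> C"
  shows "M = N"
proof (rule Levy_uniqueness[OF M N], rule ext)
  fix t :: real
  let ?e = "\<lambda>m. 4 * (t\<^sup>2 * C) ^ m / fact m"
  have le: "cmod (char M t - char N t) \<le> ?e m" for m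
  proof -
    let ?S = "\<Sum>k\<le>2 * m. ((\<i> * t) ^ k / fact k) * complex_of_real (\<integral>x. x ^ k \<partial>N)"
    have "cmod (char M t - ?S) \<le> 2 * (t\<^sup>2 * C) ^ m / fact (2 * m)"
      using real_distribution.char_bound_even[OF M int(1), of m C t] bound[of m] by (simp only: eq)
    moreover have "cmod (char N t - ?S) \<le> 2 * (t\<^sup>2 * C) ^ m / fact (2 * m)"
      by (rule real_distribution.char_bound_even[OF N int(2) bound])
    moreover have "cmod (char M t - char N t) \<le> cmod (char M t - ?S) + cmod (char N t - ?S)"
      using norm_triangle_ineq4[of "char M t - ?S" "char N t - ?S"] by simp
    ultimately have "cmod (char M t - char N t) \<le> 4 * (t\<^sup>2 * C) ^ m / fact (2 * m)" by simp
    \<comment> \<open>Weakening \<open>fact (2 * m)\<close> to \<open>fact m\<close> makes the bound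
      a multiple of a term of the exponential series.\<close>
    also have "\<dots> \<le> ?e m"
      using C by (intro divide_left_mono fact_mono mult_nonneg_nonneg) auto
    finally show ?thesis .
  qed
  have "(\<lambda>m. inverse (fact m) * (t\<^sup>2 * C) ^ m) \<longlonglongrightarrow> 0"
    by (rule summable_LIMSEQ_zero[OF summable_exp])
  from tendsto_mult_left[OF this, of 4] have "?e \<longlonglongrightarrow> 0" by (simp add: divide_inverse ac_simps)
  then have "cmod (char M t - char N t) \<le> 0"
    by (rule LIMSEQ_le_const) (use le in auto)
  then show "char M t = char N t" by simp
qed

section \<open>The measure with this density: orthogonality and uniqueness\<close>

context asc_params
begin

definition asc_measure :: "real measure" where
  "asc_measure = density lborel (\<lambda>x. ennreal (asc_density q a b x))"

lemma
  fixes f :: "real \<Rightarrow> real"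
  assumes f: "continuous_on UNIV f"
  shows integrable_asc_measure: "integrable asc_measure f"
    and integral_asc_measure: "integral\<^sup>L asc_measure f = (\<integral>x. asc_density q a b x * f x \<partial>lborel)"
proof -
  have meas: "f \<in> borel_measurable lborel" "asc_density q a b \<in> borel_measurable lborel"
    using borel_measurable_continuous_onI[OF f] by simp_all
  show "integrable asc_measure f"
    unfolding asc_measure_def
    by (subst integrable_density) (use meas asc_density_nonneg asc_density_integral(1)[OF f] in auto)
  show "integral\<^sup>L asc_measure f = (\<integral>x. asc_density q a b x * f x \<partial>lborel)"
    unfolding asc_measure_def
    by (subst integral_density) (use meas asc_density_nonneg in auto)
qed

lemma integrable_asc_measure_poly: "integrable asc_measure (poly f)"
  by (rule integrable_asc_measure) (intro continuous_intros)

lemma integral_asc_measure_poly: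
  "integral\<^sup>L asc_measure (poly (al_salam_chihara q a b n)) = (if n = 0 then 1 else 0)"
  by (subst integral_asc_measure) (simp_all add: asc_density_poly_integral continuous_intros)

lemma prob_space_asc_measure: "prob_space asc_measure"
proof
  have int: "integrable lborel (\<lambda>x. asc_density q a b x)" "(\<integral>x. asc_density q a b x \<partial>lborel) = 1"
    using asc_density_integral(1)[of "\<lambda>x. 1"] asc_density_poly_integral[of 0] by simp_all
  have "emeasure asc_measure (space asc_measure) = (\<integral>\<^sup>+ x. ennreal (asc_density q a b x) \<partial>lborel)"
    by (simp add: asc_measure_def emeasure_density)
  also have "\<dots> = 1"
    using int asc_density_nonneg by (subst nn_integral_eq_integral) auto
  finally show "emeasure asc_measure (space asc_measure) = 1" .
qed

text \<open>So far only the integrals of single polynomials are known. Writing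
  \<open>f = c + x g\<close> and expanding \<open>x p_n\<close> by the recurrence pairs
  \<open>g\<close>, which has one coefficient fewer, with the polynomials of degree
  \<open>n + 1\<close>, \<open>n\<close> and \<open>n - 1\<close>; the bound
  \<open>d \<le> n\<close> survives the drop to \<open>n - 1\<close>.\<close>

lemma asc_measure_orthogonal_lower:
  assumes "\<forall>i\<ge>d. coeff f i = 0" "d \<le> n" "1 \<le> n"
  shows "(\<integral>x. poly f x * poly (al_salam_chihara q a b n) x \<partial>asc_measure) = 0"
  using assms
proof (induction d arbitrary: f n)
  case 0
  then have "f = 0" by (simp add: poly_eq_iff)
  then show ?case by simp
next
  case (Suc d)
  let ?p = "al_salam_chihara q a b"
  obtain m where n: "n = Suc m" using Suc.prems by (cases n) auto
  obtain c g where f: "f = pCons c g" by (cases f)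
  have g: "\<forall>i\<ge>d. coeff g i = 0"
    using Suc.prems(1) by (auto simp: f dest: spec[of _ "Suc _"])
  define \<alpha> where "\<alpha> = a * q ^ Suc m"
  define \<beta> where "\<beta> = (1 - b * q ^ m) * q_bracket q (Suc m)"
  have int: "integrable asc_measure (\<lambda>x. poly g x * poly (?p k) x)" for k
    using integrable_asc_measure_poly[of "g * ?p k"] by (simp add: poly_mult[abs_def])
  \<comment> \<open>The induction hypothesis asks for \<open>1 \<le> k\<close>; for
    \<open>k = 0\<close> the bound forces \<open>d = 0\<close>, hence \<open>g = 0\<close>.\<close>
  have z: "(\<integral>x. poly g x * poly (?p k) x \<partial>asc_measure) = 0" if "d \<le> k" for k
  proof (cases "k = 0")
    case True
    with that g have "g = 0" by (simp add: poly_eq_iff)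
    then show ?thesis by simp
  next
    case False
    with Suc.IH[OF g that] show ?thesis by simp
  qed
  have "poly f x * poly (?p n) x = c * poly (?p n) x + (poly g x * poly (?p (Suc (Suc m))) x
     + \<alpha> * (poly g x * poly (?p (Suc m)) x) + \<beta> * (poly g x * poly (?p m) x))" for x
  proof -
    have "poly f x * poly (?p n) x = c * poly (?p n) x + poly g x * (x * poly (?p (Suc m)) x)"
      by (simp add: f n algebra_simps del: al_salam_chihara.simps)
    then show ?thesis
      unfolding al_salam_chihara_recurrence \<alpha>_def[symmetric] \<beta>_def[symmetric]
      by (simp only: distrib_left mult_ac)
  qed
  moreover have "integral\<^sup>L asc_measure (poly (?p n)) = 0"
    unfolding integral_asc_measure_poly using Suc.prems(3) by simp
  ultimately show ?case
    using int integrable_asc_measure_poly[of "?p n"] z Suc.prems(2)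
    by (simp add: n del: al_salam_chihara.simps)
qed

lemma asc_measure_orthogonality: "is_orthogonality_distribution asc_measure (al_salam_chihara q a b)"
  unfolding is_orthogonality_distribution_def
proof (intro conjI allI impI)
  let ?p = "al_salam_chihara q a b"
  show "prob_space asc_measure" by (rule prob_space_asc_measure)
  show "sets asc_measure = sets borel" by (simp add: asc_measure_def)
  show "integrable asc_measure (\<lambda>x. poly (?p m) x * poly (?p n) x)" for m n
    using integrable_asc_measure_poly[of "?p m * ?p n"] by (simp add: poly_mult[abs_def])
  have lt: "(\<integral>x. poly (?p m) x * poly (?p n) x \<partial>asc_measure) = 0" if "m < n" for m n
    by (rule asc_measure_orthogonal_lower[of "Suc m"])
       (use that coeff_al_salam_chihara[of m q a b] in auto)
  show "(\<integral>x. poly (?p m) x * poly (?p n) x \<partial>asc_measure) = 0" if "m \<noteq> n" for m n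
  proof (cases "m < n")
    case False
    then have "n < m" using that by simp
    from lt[OF this] show ?thesis by (simp add: mult.commute)
  qed (rule lt)
qed

text \<open>The density vanishes unless \<open>x\<^sup>2 < 4 / (1 - q)\<close>, and its total mass
  is 1.\<close>

lemma asc_measure_moment_bound: "(\<integral>x. x ^ (2 * m) \<partial>asc_measure) \<le> (4 / (1 - q)) ^ m"
proof -
  let ?C = "(4 / (1 - q)) ^ m"
  have "(\<integral>x. x ^ (2 * m) \<partial>asc_measure) = (\<integral>x. asc_density q a b x * x ^ (2 * m) \<partial>lborel)"
    by (intro integral_asc_measure continuous_intros)
  also have "\<dots> \<le> (\<integral>x. asc_density q a b x * ?C \<partial>lborel)"
  proof (rule integral_mono)
    show "integrable lborel (\<lambda>x. asc_density q a b x * x ^ (2 * m))"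
      "integrable lborel (\<lambda>x. asc_density q a b x * ?C)"
      by (intro asc_density_integral(1) continuous_intros)+
    show "asc_density q a b x * x ^ (2 * m) \<le> asc_density q a b x * ?C" for x
    proof (cases "x\<^sup>2 < 4 / (1 - q)")
      case True
      then have "x ^ (2 * m) \<le> ?C" unfolding power_mult by (intro power_mono) auto
      then show ?thesis by (intro mult_left_mono asc_density_nonneg)
    qed (simp add: asc_density_def)
  qed
  also have "\<dots> = ?C"
    using asc_density_poly_integral[of 0] by simp
  finally show ?thesis .
qed

text \<open>Orthogonality gives \<open>M\<close> and \<open>asc_measure\<close> equal moments, and
  the bounded support of \<open>asc_measure\<close> supplies the growth bound; nothing is assumed
  about the support of \<open>M\<close>.\<close>

lemma orthogonality_distribution_unique:
  assumes M: "is_orthogonality_distribution M (al_salam_chihara q a b)"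
  shows "M = asc_measure"
proof (rule real_distribution_eq_of_moments)
  have rd: "real_distribution M" if "is_orthogonality_distribution M (al_salam_chihara q a b)" for M
    using that unfolding is_orthogonality_distribution_def real_distribution_def real_distribution_axioms_def
    by simp
  show "real_distribution M" "real_distribution asc_measure"
    using rd M asc_measure_orthogonality by blast+
  note * = orthogonality_distribution_poly_integrals[OF M asc_measure_orthogonality
      al_salam_chihara.simps(1) coeff_al_salam_chihara]
  have mon: "(\<lambda>x::real. x ^ k) = poly (monom 1 k)" for k by (simp add: fun_eq_iff poly_monom)
  show "integrable M (\<lambda>x. x ^ k)" "integrable asc_measure (\<lambda>x. x ^ k)"
    "(\<integral>x. x ^ k \<partial>M) = (\<integral>x. x ^ k \<partial>asc_measure)" for k
    unfolding mon using * by blast+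
  show "(\<integral>x. x ^ (2 * m) \<partial>asc_measure) \<le> (4 / (1 - q)) ^ m" for m
    by (rule asc_measure_moment_bound)
  show "0 \<le> 4 / (1 - q)" using q by simp
qed

end

theorem corollary3:
  fixes q a b :: real
  assumes "\<bar>q\<bar> < 1" and "0 < b" and "b < 1" and "a\<^sup>2 * (1 - q) < 4 * b"
  shows "(\<exists>!M. is_orthogonality_distribution M (al_salam_chihara q a b)) \<and>
    (\<forall>M. is_orthogonality_distribution M (al_salam_chihara q a b) \<longrightarrow>
       absolutely_continuous lborel M \<and>
       M = density lborel (\<lambda>x. ennreal (asc_density q a b x))) \<and>
    (\<forall>x. x\<^sup>2 < 4 / (1 - q) \<longrightarrow>
       (\<forall>k. asc_denominator q a b x k \<noteq> 0) \<and>
       convergent_prod (asc_factor q a b x) \<and>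
       0 \<le> asc_density q a b x)"
proof -
  interpret asc_params q a b by unfold_locales (use assms in auto)
  have ac: "absolutely_continuous lborel asc_measure"
    unfolding asc_measure_def
    by (rule absolutely_continuousI_density) (use measurable_asc_density in simp)
  have "asc_denominator q a b x k \<noteq> 0 \<and> convergent_prod (asc_factor q a b x) \<and> 0 \<le> asc_density q a b x"
    if x: "x\<^sup>2 < 4 / (1 - q)" for x k
  proof -
    from x obtain \<theta> where \<theta>: "qscale * x = 2 * cos \<theta>" by (rule support_param)
    show ?thesis
      using asc_denominator_pos[OF \<theta>, of k] convergent_prod_asc_factor[OF \<theta>] asc_density_nonneg by simp
  qed
  with ac show ?thesis
    using asc_measure_orthogonality orthogonality_distribution_unique
    unfolding asc_measure_def[symmetric] by blast
qed

end
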